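(* Let $T$ be a tree of order $n$ and let $\alpha\in (0,1)$. Then \[E^{\mathcal{D}_\alpha}(T)\geq\alpha n+2n-4+\sqrt{k}- \frac{4\alpha W(T)}{n},\] where $k=(n^2-2n+2)(\alpha-2)^2+2(n-1)(\alpha^2-2)$. Moreover, for $0<\alpha<\frac{2n}{3n-2}$, equality holds if and only if $T$ is the star $S_{n}$.
   Context: For a connected graph $G$ of order $n$, $d(u,v)$ is the shortest-path distance, $\mathcal{D}(G)$ the distance matrix, $Tr(v)=\sum_u d(u,v)$ the transmission of $v$, $Tr(G)$ the diagonal matrix of transmissions, and $W(G)=\frac12\sum_v Tr(v)$ the Wiener index. For $0\le\alpha\le1$ the generalized distance matrix is $\mathcal{D}_\alpha(G)=\alpha Tr(G)+(1-\alpha)\mathcal{D}(G)$, with eigenvalues $\partial_1\ge\dots\ge\partial_n$. The generalized distance energy is $E^{\mathcal{D}_\alpha}(G)=\sum_{i=1}^n\left|\partial_i-\frac{2\alpha W(G)}{n}\right|$. *)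

theory Defs
  imports "Jordan_Normal_Form.Char_Poly"
begin

text \<open>
  Finite simple undirected graphs, given by a vertex set \<open>V\<close> and a set \<open>E\<close> of two-element
  subsets of \<open>V\<close>. (In the symmetric digraphs of the AFP entry Graph\_Theory a walk \<open>a, b, a\<close>
  counts as a cycle, so the trees of that entry are not undirected trees.)
\<close>

definition simple_graph :: "'a set \<Rightarrow> 'a set set \<Rightarrow> bool" where
  "simple_graph V E \<longleftrightarrow> finite V \<and> E \<subseteq> {e. e \<subseteq> V \<and> card e = 2}"

definition is_path :: "'a set \<Rightarrow> 'a set set \<Rightarrow> 'a list \<Rightarrow> bool" where
  "is_path V E p \<longleftrightarrow>
     p \<noteq> [] \<and> distinct p \<and> set p \<subseteq> V \<and> successively (\<lambda>x y. {x, y} \<in> E) p"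

definition path_between :: "'a set \<Rightarrow> 'a set set \<Rightarrow> 'a \<Rightarrow> 'a list \<Rightarrow> 'a \<Rightarrow> bool" where
  "path_between V E u p v \<longleftrightarrow> is_path V E p \<and> hd p = u \<and> last p = v"

definition connected_graph :: "'a set \<Rightarrow> 'a set set \<Rightarrow> bool" where
  "connected_graph V E \<longleftrightarrow>
     simple_graph V E \<and> V \<noteq> {} \<and> (\<forall>u\<in>V. \<forall>v\<in>V. \<exists>p. path_between V E u p v)"

definition is_cycle :: "'a set \<Rightarrow> 'a set set \<Rightarrow> 'a list \<Rightarrow> bool" where
  "is_cycle V E p \<longleftrightarrow> is_path V E p \<and> length p \<ge> 3 \<and> {last p, hd p} \<in> E"

definition is_tree :: "'a set \<Rightarrow> 'a set set \<Rightarrow> bool" where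
  "is_tree V E \<longleftrightarrow> connected_graph V E \<and> (\<nexists>p. is_cycle V E p)"

text \<open>Being a star \<open>S\<^sub>n = K\<^sub>1\<^sub>,\<^sub>n\<^sub>-\<^sub>1\<close> up to isomorphism; \<open>S\<^sub>1\<close> is the single vertex.\<close>

definition is_star :: "'a set \<Rightarrow> 'a set set \<Rightarrow> bool" where
  "is_star V E \<longleftrightarrow> finite V \<and> (\<exists>c\<in>V. E = {{c, v} | v. v \<in> V - {c}})"

text \<open>The length of a path is its number of edges, one less than its number of vertices.\<close>

definition graph_dist :: "'a set \<Rightarrow> 'a set set \<Rightarrow> 'a \<Rightarrow> 'a \<Rightarrow> nat" where
  "graph_dist V E u v = (LEAST l. \<exists>p. path_between V E u p v \<and> l = length p - 1)"

definition transmission :: "'a set \<Rightarrow> 'a set set \<Rightarrow> 'a \<Rightarrow> real" where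
  "transmission V E v = (\<Sum>u\<in>V. real (graph_dist V E u v))"

definition wiener_index :: "'a set \<Rightarrow> 'a set set \<Rightarrow> real" where
  "wiener_index V E = 1 / 2 * (\<Sum>v\<in>V. transmission V E v)"

text \<open>
  The matrices are taken with respect to an enumeration \<open>vs\<close> of the vertices (a list without
  repetitions whose set of elements is \<open>V\<close>); row and column \<open>i\<close> belong to \<open>vs ! i\<close>.
\<close>

definition distance_matrix :: "'a set \<Rightarrow> 'a set set \<Rightarrow> 'a list \<Rightarrow> real mat" where
  "distance_matrix V E vs =
     mat (length vs) (length vs) (\<lambda>(i, j). real (graph_dist V E (vs ! i) (vs ! j)))"

definition transmission_matrix :: "'a set \<Rightarrow> 'a set set \<Rightarrow> 'a list \<Rightarrow> real mat" where
  "transmission_matrix V E vs =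
     mat (length vs) (length vs) (\<lambda>(i, j). if i = j then transmission V E (vs ! i) else 0)"

definition gen_distance_matrix :: "'a set \<Rightarrow> 'a set set \<Rightarrow> 'a list \<Rightarrow> real \<Rightarrow> real mat" where
  "gen_distance_matrix V E vs \<alpha> =
     \<alpha> \<cdot>\<^sub>m transmission_matrix V E vs + (1 - \<alpha>) \<cdot>\<^sub>m distance_matrix V E vs"

text \<open>
  The eigenvalues with algebraic multiplicity, as the multiset of real roots of the
  characteristic polynomial. The matrix is real symmetric, so this polynomial splits over the
  reals and the multiset has as many elements as the graph has vertices.
\<close>

definition gen_distance_eigenvalues ::
    "'a set \<Rightarrow> 'a set set \<Rightarrow> 'a list \<Rightarrow> real \<Rightarrow> real multiset" where
  "gen_distance_eigenvalues V E vs \<alpha> = proots (char_poly (gen_distance_matrix V E vs \<alpha>))"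

definition gen_distance_energy :: "'a set \<Rightarrow> 'a set set \<Rightarrow> 'a list \<Rightarrow> real \<Rightarrow> real" where
  "gen_distance_energy V E vs \<alpha> =
     (\<Sum>\<mu>\<in>#gen_distance_eigenvalues V E vs \<alpha>.
        \<bar>\<mu> - 2 * \<alpha> * wiener_index V E / real (card V)\<bar>)"

end

theory Submission
  imports Defs "Jordan_Normal_Form.Schur_Decomposition"
begin

text \<open>
  The mean \<open>m = 2 * \<alpha> * W / n\<close> of the eigenvalues makes the deviations sum to zero, so the energy is
  twice the sum of the positive deviations and hence at least \<open>2 * (\<rho> - m)\<close> for every Rayleigh
  quotient \<open>\<rho>\<close>. Take the Perron vector of the star, with the central value put at a vertex \<open>c\<close> of
  degree at least 2. Then \<open>\<rho>\<close> is increasing in \<open>Tr(c) \<ge> n - 1\<close> and in the sum of the distances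
  avoiding \<open>c\<close>, and the latter is at least its value for the star. Thus \<open>\<rho>\<close> is at least the
  largest eigenvalue of the star, strictly unless \<open>Tr(c) = n - 1\<close>, which forces a star. For the
  star itself the bound on \<open>\<alpha>\<close> puts all other eigenvalues at or below \<open>m\<close>, so equality holds.
\<close>

section \<open>Symmetric real matrices\<close>

text \<open>Over the complex numbers the characteristic polynomial has a root \<open>z\<close> with
  eigenvector \<open>w\<close>. The Hermitian form of \<open>A\<close> at \<open>w\<close> equals
  \<open>z\<close> times the squared norm of \<open>w\<close>, and the symmetry of \<open>A\<close>
  makes it real; hence \<open>z\<close> is real.\<close>

lemma symmetric_real_mat_eigenvector:
  fixes A :: "real mat"
  assumes A: "A \<in> carrier_mat n n" and sym: "transpose_mat A = A" and n: "n > 0"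
  obtains v e where "eigenvector A v e"
proof -
  define C where "C = map_mat complex_of_real A"
  have C: "C \<in> carrier_mat n n" using A by (simp add: C_def)
  obtain as where as: "char_poly C = (\<Prod>a\<leftarrow>as. [:- a, 1:])" "length as = n"
    using char_poly_factorized[OF C] by blast
  define z where "z = hd as"
  have "poly (char_poly C) z = 0"
    using as n by (cases as) (auto simp: z_def)
  then have "eigenvalue C z" by (simp add: eigenvalue_root_char_poly[OF C])
  then obtain w where w: "w \<in> carrier_vec n" "w \<noteq> 0\<^sub>v n" "C *\<^sub>v w = z \<cdot>\<^sub>v w"
    using C unfolding eigenvalue_def eigenvector_def by auto
  have row: "(\<Sum>j<n. of_real (A $$ (i, j)) * w $ j) = z * w $ i" if "i < n" for i
  proof -
    have "(C *\<^sub>v w) $ i = z * w $ i" using w that by simp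
    moreover have "(C *\<^sub>v w) $ i = (\<Sum>j<n. of_real (A $$ (i, j)) * w $ j)"
      using w(1) that A C by (simp add: scalar_prod_def C_def atLeast0LessThan)
    ultimately show ?thesis by simp
  qed
  have symA: "A $$ (i, j) = A $$ (j, i)" if "i < n" "j < n" for i j
    using that A sym by (metis carrier_matD index_transpose_mat(1))
  define N where "N = (\<Sum>i<n. (cmod (w $ i))\<^sup>2)"
  define S where "S = (\<Sum>i<n. cnj (w $ i) * (\<Sum>j<n. of_real (A $$ (i, j)) * w $ j))"
  have "cnj a * (z * a) = z * of_real ((cmod a)\<^sup>2)" for a
    unfolding complex_norm_square by (simp add: algebra_simps)
  then have "S = (\<Sum>i<n. z * of_real ((cmod (w $ i))\<^sup>2))"
    unfolding S_def by (intro sum.cong) (simp_all only: row lessThan_iff)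
  then have SN: "S = z * of_real N" by (simp add: N_def sum_distrib_left)
  have "cnj S = (\<Sum>i<n. \<Sum>j<n. w $ i * (of_real (A $$ (i, j)) * cnj (w $ j)))"
    by (simp add: S_def sum_distrib_left)
  also have "\<dots> = (\<Sum>j<n. \<Sum>i<n. w $ i * (of_real (A $$ (i, j)) * cnj (w $ j)))"
    by (rule sum.swap)
  also have "\<dots> = S" unfolding S_def sum_distrib_left
    by (intro sum.cong refl) (auto simp: symA mult_ac)
  finally have "S \<in> \<real>" by (simp add: complex_is_Real_iff complex_eq_iff)
  obtain i where i: "i < n" "w $ i \<noteq> 0"
    using w(1,2) by (metis eq_vecI carrier_vecD index_zero_vec)
  then have "N > 0" unfolding N_def by (intro sum_pos2[of _ i]) auto
  then have "z = S / of_real N" using SN by simp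
  then obtain e where e: "z = of_real e" using \<open>S \<in> \<real>\<close> by (metis Reals_cases Reals_divide Reals_of_real)
  \<comment> \<open>The vector \<open>w\<close> is complex; a real eigenvector exists because the
    real number \<open>e\<close> is a root of the characteristic polynomial of \<open>A\<close>
    itself.\<close>
  have "of_real (poly (char_poly A) e) = (0 :: complex)"
    using \<open>poly (char_poly C) z = 0\<close>
    unfolding C_def of_real_hom.char_poly_hom[OF A] e by simp
  then have "eigenvalue A e" by (simp add: eigenvalue_root_char_poly[OF A])
  then show ?thesis using that unfolding eigenvalue_def by blast
qed

text \<open>Gram-Schmidt applied to a basis that starts with \<open>v\<close> leaves its first
  vector unchanged; after normalising, the first column is a multiple of \<open>v\<close>.\<close>

lemma orthogonal_mat_first_col:
  fixes v :: "real vec"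
  assumes v: "v \<in> carrier_vec n" "v \<noteq> 0\<^sub>v n" and n: "n > 0"
  obtains W c where "W \<in> carrier_mat n n" "transpose_mat W * W = 1\<^sub>m n" "col W 0 = c \<cdot>\<^sub>v v"
proof -
  interpret cof_vec_space n "TYPE(real)" .
  define ws where "ws = gram_schmidt n (basis_completion v)"
  note bc = basis_completion[OF v]
  obtain vs where bv: "basis_completion v = v # vs"
    using bc(6,7) n by (cases "basis_completion v") auto
  have ws: "set ws \<subseteq> carrier_vec n" "corthogonal ws" "length ws = n"
    using gram_schmidt_result[OF bc(2,4,5) ws_def] bc(6) by auto
  have hd: "hd ws = v" using gram_schmidt_hd[OF v(1), of vs] by (simp add: ws_def bv)
  \<comment> \<open>The orthogonality of \<open>ws\<close> is stated with conjugates, which are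
    trivial over the reals.\<close>
  have conj: "conjugate w = w" for w :: "real vec"
    by (rule eq_vecI) auto
  define W where "W = mat_of_cols n (map (\<lambda>w. (1 / sqrt (w \<bullet> w)) \<cdot>\<^sub>v w) ws)"
  have W: "W \<in> carrier_mat n n" using ws by (intro carrier_matI) (simp_all add: W_def)
  have wsn: "ws ! i \<in> carrier_vec n" if "i < n" for i using ws that by (auto simp: subset_iff)
  have colW: "col W i = (1 / sqrt (ws ! i \<bullet> ws ! i)) \<cdot>\<^sub>v ws ! i" if "i < n" for i
    unfolding W_def using ws that wsn[OF that] by (subst col_mat_of_cols) auto
  have "transpose_mat W * W = 1\<^sub>m n"
  proof (rule eq_matI)
    fix i j assume ij: "i < dim_row (1\<^sub>m n :: real mat)" "j < dim_col (1\<^sub>m n :: real mat)"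
    then have ij: "i < n" "j < n" by auto
    have orth: "(ws ! i \<bullet> ws ! j = 0) = (i \<noteq> j)"
      using corthogonalD[OF ws(2), of i j] ij ws(3) by (simp add: conj)
    have pos: "ws ! i \<bullet> ws ! i \<ge> 0" by (simp add: scalar_prod_def sum_nonneg)
    have "(transpose_mat W * W) $$ (i, j) = col W i \<bullet> col W j"
      using ij W by simp
    also have "\<dots> = (1 / sqrt (ws ! i \<bullet> ws ! i)) * (1 / sqrt (ws ! j \<bullet> ws ! j)) * (ws ! i \<bullet> ws ! j)"
      using ij wsn[OF ij(1)] wsn[OF ij(2)] by (simp add: colW)
    also have "\<dots> = 1\<^sub>m n $$ (i, j)"
      using orth pos ij by (auto simp: field_simps)
    finally show "(transpose_mat W * W) $$ (i, j) = 1\<^sub>m n $$ (i, j)" .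
  qed (use W in auto)
  moreover have "ws ! 0 = v" using hd ws(3) n by (cases ws) auto
  ultimately show ?thesis using that[OF W] colW[OF n] by auto
qed

text \<open>Deflation: with an eigenvector as first column, the orthogonal \<open>W\<close> turns
  \<open>A\<close> into a matrix whose first column vanishes below its top entry. By symmetry the
  first row vanishes to the right of it as well, and the induction hypothesis applies to the
  remaining block.\<close>

lemma real_spectral_mat:
  fixes A :: "real mat"
  assumes "A \<in> carrier_mat n n" and "transpose_mat A = A"
  shows "\<exists>P e. P \<in> carrier_mat n n \<and> transpose_mat P * P = 1\<^sub>m n
           \<and> transpose_mat P * A * P = mat_diag n e"
  using assms
proof (induction n arbitrary: A)
  case 0
  then show ?case
    by (intro exI[of _ "1\<^sub>m 0"] exI[of _ "\<lambda>_. 0"]) (auto simp: mat_diag_def intro!: eq_matI)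
next
  case (Suc n A)
  note A = Suc.prems(1)
  obtain v l where "eigenvector A v l"
    using symmetric_real_mat_eigenvector[OF A Suc.prems(2)] by auto
  then have v: "v \<in> carrier_vec (Suc n)" "v \<noteq> 0\<^sub>v (Suc n)" "A *\<^sub>v v = l \<cdot>\<^sub>v v"
    using A by (auto simp: eigenvector_def)
  obtain W c where W: "W \<in> carrier_mat (Suc n) (Suc n)"
      and WW: "transpose_mat W * W = 1\<^sub>m (Suc n)" and W0: "col W 0 = c \<cdot>\<^sub>v v"
    using orthogonal_mat_first_col[OF v(1,2)] by auto
  define B where "B = transpose_mat W * A * W"
  have B: "B \<in> carrier_mat (Suc n) (Suc n)" using W A by (simp add: B_def)
  have Wt: "transpose_mat W \<in> carrier_mat (Suc n) (Suc n)" using W by simp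
  have Bsym: "transpose_mat B = B"
    using W A Wt Suc.prems(2)
    by (simp add: B_def transpose_mult[of _ "Suc n" "Suc n" _ "Suc n"] assoc_mult_mat[of _ "Suc n" "Suc n" _ "Suc n" _ "Suc n"])
  have colB: "B $$ (i, 0) = (if i = 0 then l else 0)" if "i < Suc n" for i
  proof -
    have "A *\<^sub>v col W 0 = l \<cdot>\<^sub>v col W 0"
      unfolding W0 using v A by (simp add: mult_mat_vec smult_smult_assoc mult_ac)
    moreover have "col (A * W) 0 = A *\<^sub>v col W 0"
      by (rule eq_vecI) (use A W in auto)
    moreover have "B = transpose_mat W * (A * W)" using A W Wt by (simp add: B_def)
    ultimately have "B $$ (i, 0) = col W i \<bullet> (l \<cdot>\<^sub>v col W 0)"
      using that A W by simp
    also have "\<dots> = l * (transpose_mat W * W) $$ (i, 0)"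
      using W that by simp
    finally show ?thesis unfolding WW using that by simp
  qed
  define B3 where "B3 = mat n n (\<lambda>(i, j). B $$ (Suc i, Suc j))"
  have symB: "B $$ (i, j) = B $$ (j, i)" if "i < Suc n" "j < Suc n" for i j
    using that B Bsym by (metis carrier_matD index_transpose_mat(1))
  have Bblock: "B = four_block_mat (mat 1 1 (\<lambda>_. l)) (0\<^sub>m 1 n) (0\<^sub>m n 1) B3"
    by (rule eq_matI) (use B colB symB[of 0] in \<open>auto simp: B3_def\<close>)
  have B3: "B3 \<in> carrier_mat n n" "transpose_mat B3 = B3"
    by (auto simp: B3_def intro!: eq_matI symB)
  obtain Q e where Q: "Q \<in> carrier_mat n n" "transpose_mat Q * Q = 1\<^sub>m n"
      "transpose_mat Q * B3 * Q = mat_diag n e"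
    using Suc.IH[OF B3] by blast
  \<comment> \<open>\<open>R\<close> fixes the first coordinate and acts by \<open>Q\<close> on the
    others, so \<open>W * R\<close> is orthogonal and diagonalises \<open>A\<close>.\<close>
  define R where "R = four_block_mat (1\<^sub>m 1) (0\<^sub>m 1 n) (0\<^sub>m n 1) Q"
  have R: "R \<in> carrier_mat (Suc n) (Suc n)"
    using Q four_block_carrier_mat[of "1\<^sub>m 1" 1 1 Q n n] by (simp add: R_def)
  have Rt: "transpose_mat R = four_block_mat (1\<^sub>m 1) (0\<^sub>m 1 n) (0\<^sub>m n 1) (transpose_mat Q)"
    unfolding R_def using Q by (subst transpose_four_block_mat[of _ 1 1 _ n _ n]) (auto simp: transpose_one)
  have RR: "transpose_mat R * R = 1\<^sub>m (Suc n)"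
    unfolding Rt unfolding R_def using Q(1,2) by (subst mult_four_block_mat[of _ 1 1 _ n _ n]) auto
  have RBR: "transpose_mat R * B * R = mat_diag (Suc n) (case_nat l e)"
  proof -
    have "transpose_mat R * B = four_block_mat (mat 1 1 (\<lambda>_. l)) (0\<^sub>m 1 n) (0\<^sub>m n 1) (transpose_mat Q * B3)"
      unfolding Rt Bblock using Q B3 by (subst mult_four_block_mat[of _ 1 1 _ n _ n]) auto
    then have "transpose_mat R * B * R = four_block_mat (mat 1 1 (\<lambda>_. l)) (0\<^sub>m 1 n) (0\<^sub>m n 1) (mat_diag n e)"
      unfolding R_def using Q B3 by (simp, subst mult_four_block_mat[of _ 1 1 _ n _ n]) auto
    also have "\<dots> = mat_diag (Suc n) (case_nat l e)"
      by (rule eq_matI) (auto simp: mat_diag_def split: nat.splits)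
    finally show ?thesis .
  qed
  have Rtc: "transpose_mat R \<in> carrier_mat (Suc n) (Suc n)" using R by simp
  note assoc = assoc_mult_mat[of _ "Suc n" "Suc n" _ "Suc n" _ "Suc n"]
  have WR: "W * R \<in> carrier_mat (Suc n) (Suc n)" using W R by simp
  have WRt: "transpose_mat (W * R) = transpose_mat R * transpose_mat W"
    using W R by (rule transpose_mult)
  have "transpose_mat (W * R) * (W * R) = transpose_mat R * (transpose_mat W * W) * R"
    unfolding WRt using W R Wt Rtc by (simp add: assoc)
  moreover have "transpose_mat (W * R) * A * (W * R) = transpose_mat R * B * R"
    unfolding WRt B_def using W R Wt Rtc A by (simp add: assoc)
  ultimately show ?case
    using WR RR RBR WW Rtc by (intro exI[of _ "W * R"] exI[of _ "case_nat l e"]) auto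
qed

text \<open>Eigenvectors as functions on indices, of which only the values below \<open>n\<close>
  count; this keeps the later arguments within finite sums.\<close>

definition eigenfun :: "real mat \<Rightarrow> nat \<Rightarrow> (nat \<Rightarrow> real) \<Rightarrow> real \<Rightarrow> bool" where
  "eigenfun A n x \<mu> \<longleftrightarrow> (\<exists>i<n. x i \<noteq> 0) \<and> (\<forall>i<n. (\<Sum>j<n. A $$ (i, j) * x j) = \<mu> * x i)"

text \<open>The form in which the spectral theorem is used: the columns of \<open>P\<close> are an
  orthonormal basis of eigenvectors. Similar matrices share their characteristic polynomial, so
  \<open>e\<close> lists its roots with multiplicity.\<close>

lemma real_spectral_entries:
  fixes A :: "real mat"
  assumes A: "A \<in> carrier_mat n n" and sym: "transpose_mat A = A"
  obtains P :: "nat \<Rightarrow> nat \<Rightarrow> real" and e where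
    "\<And>j k. j < n \<Longrightarrow> k < n \<Longrightarrow> (\<Sum>i<n. P i j * P i k) = of_bool (j = k)"
    "\<And>i j. i < n \<Longrightarrow> j < n \<Longrightarrow> (\<Sum>k<n. P i k * P j k) = of_bool (i = j)"
    "\<And>i j. i < n \<Longrightarrow> j < n \<Longrightarrow> A $$ (i, j) = (\<Sum>k<n. e k * (P i k * P j k))"
    "\<And>k. k < n \<Longrightarrow> eigenfun A n (\<lambda>i. P i k) (e k)"
    "proots (char_poly A) = image_mset e (mset_set {..<n})"
proof -
  obtain P e where P: "P \<in> carrier_mat n n" and PP: "transpose_mat P * P = 1\<^sub>m n"
      and D: "transpose_mat P * A * P = mat_diag n e"
    using real_spectral_mat[OF A sym] by blast
  have Pt: "transpose_mat P \<in> carrier_mat n n" using P by simp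
  have PPt: "P * transpose_mat P = 1\<^sub>m n" using mat_mult_left_right_inverse[OF Pt P PP] .
  note assoc = assoc_mult_mat[of _ n n _ n _ n]
  have "P * (transpose_mat P * A * P) * transpose_mat P = (P * transpose_mat P) * A * (P * transpose_mat P)"
    using P Pt A by (simp add: assoc)
  then have AD: "A = P * mat_diag n e * transpose_mat P" using A by (simp add: D PPt)
  have "similar_mat A (mat_diag n e)"
    using similar_mat_witI[OF PPt PP AD A _ P Pt] unfolding similar_mat_def by auto
  then have "char_poly A = char_poly (mat_diag n e)" by (rule char_poly_similar)
  also have "\<dots> = (\<Prod>a\<leftarrow>diag_mat (mat_diag n e). [:- a, 1:])"
    by (rule char_poly_upper_triangular[of _ n]) (auto simp: mat_diag_def)
  also have "diag_mat (mat_diag n e) = map e [0..<n]"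
    by (rule nth_equalityI) (simp_all add: diag_mat_def mat_diag_def)
  also have "(\<Prod>a\<leftarrow>map e [0..<n]. [:- a, 1:]) = (\<Prod>k<n. [:- e k, 1:])"
    by (induction n) (simp_all add: mult.commute)
  finally have cp: "char_poly A = (\<Prod>k<n. [:- e k, 1:])" .
  have "proots (char_poly A) = (\<Sum>k<n. {#e k#})"
    unfolding cp by (subst proots_prod) auto
  also have "\<dots> = image_mset e (mset_set {..<n})"
    by (induction n) (simp_all add: lessThan_Suc)
  finally have roots: "proots (char_poly A) = image_mset e (mset_set {..<n})" .
  let ?P = "\<lambda>i j. P $$ (i, j)"
  have cols: "(\<Sum>i<n. ?P i j * ?P i k) = of_bool (j = k)" if "j < n" "k < n" for j k
    using arg_cong[OF PP, of "\<lambda>M. M $$ (j, k)"] P that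
    by (simp add: scalar_prod_def atLeast0LessThan)
  have rows: "(\<Sum>k<n. ?P i k * ?P j k) = of_bool (i = j)" if "i < n" "j < n" for i j
    using arg_cong[OF PPt, of "\<lambda>M. M $$ (i, j)"] P that
    by (simp add: scalar_prod_def atLeast0LessThan)
  have entry: "A $$ (i, j) = (\<Sum>k<n. e k * (?P i k * ?P j k))" if "i < n" "j < n" for i j
    using arg_cong[OF AD, of "\<lambda>M. M $$ (i, j)"] P that
    by (simp add: scalar_prod_def atLeast0LessThan mat_diag_mult_right[OF P] mult_ac)
  have "(\<Sum>j<n. A $$ (i, j) * ?P j k) = e k * ?P i k" if "i < n" "k < n" for i k
  proof -
    have "(\<Sum>j<n. A $$ (i, j) * ?P j k) = (\<Sum>j<n. \<Sum>l<n. e l * ?P i l * (?P j l * ?P j k))"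
      using that by (intro sum.cong) (simp_all add: entry sum_distrib_left sum_distrib_right mult_ac)
    also have "\<dots> = (\<Sum>l<n. e l * ?P i l * (\<Sum>j<n. ?P j l * ?P j k))"
      by (subst sum.swap) (simp add: sum_distrib_left)
    also have "\<dots> = (\<Sum>l<n. if l = k then e l * ?P i l else 0)"
      using that by (intro sum.cong) (simp_all add: cols)
    finally show ?thesis using that by simp
  qed
  moreover have "\<exists>i<n. ?P i k \<noteq> 0" if "k < n" for k
  proof (rule ccontr)
    assume "\<not> ?thesis"
    then have "(\<Sum>i<n. ?P i k * ?P i k) = 0" by (intro sum.neutral) auto
    then show False using cols[OF that that] by simp
  qed
  ultimately have "eigenfun A n (\<lambda>i. ?P i k) (e k)" if "k < n" for k
    using that by (simp add: eigenfun_def)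
  then show ?thesis using that[of ?P e] cols rows entry roots by blast
qed

section \<open>Absolute deviations of the eigenvalues from their mean\<close>

text \<open>The deviations sum to zero, so \<open>e j - m\<close> is offset by the other deviations,
  whose absolute values add up to at least \<open>e j - m\<close>. Together with the term of
  \<open>j\<close> itself this gives the factor 2.\<close>

lemma sum_abs_deviation_ge:
  fixes e :: "'b \<Rightarrow> real"
  assumes "finite I" "j \<in> I" and "sum e I = real (card I) * m"
  shows "2 * (e j - m) \<le> (\<Sum>k\<in>I. \<bar>e k - m\<bar>)"
proof -
  have "(\<Sum>k\<in>I. e k - m) = 0" using assms(3) by (simp add: sum_subtractf)
  then have "e j - m = - (\<Sum>k\<in>I - {j}. e k - m)" using assms by (simp add: sum.remove)
  also have "\<dots> \<le> (\<Sum>k\<in>I - {j}. \<bar>e k - m\<bar>)" by (simp add: sum_mono flip: sum_negf)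
  finally show ?thesis using assms by (simp add: sum.remove[of I j])
qed

text \<open>As the deviations sum to zero, the left-hand side is twice the sum of the positive ones;
  by \<open>one\<close> and \<open>le\<close> there is at most one of these, bounded by
  \<open>l - m\<close>. The assumption \<open>m \<le> l\<close> settles the case that there is
  none.\<close>

lemma sum_abs_deviation_le:
  fixes e :: "'b \<Rightarrow> real"
  assumes fin: "finite I" and sum: "sum e I = real (card I) * m"
    and ml: "m \<le> l"
    and one: "\<And>j k. j \<in> I \<Longrightarrow> k \<in> I \<Longrightarrow> e j > m \<Longrightarrow> e k > m \<Longrightarrow> j = k"
    and le: "\<And>k. k \<in> I \<Longrightarrow> e k > m \<Longrightarrow> e k \<le> l"
  shows "(\<Sum>k\<in>I. \<bar>e k - m\<bar>) \<le> 2 * (l - m)"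
proof -
  have 0: "(\<Sum>k\<in>I. e k - m) = 0" using sum by (simp add: sum_subtractf)
  have "(\<Sum>k\<in>I. \<bar>e k - m\<bar>) = (\<Sum>k\<in>I. 2 * max 0 (e k - m) - (e k - m))"
    by (intro sum.cong) (auto simp: max_def)
  also have "\<dots> = 2 * (\<Sum>k\<in>I. max 0 (e k - m))"
    using 0 by (simp add: sum_subtractf sum_distrib_left)
  also have "(\<Sum>k\<in>I. max 0 (e k - m)) \<le> l - m"
  proof (cases "\<exists>j\<in>I. e j > m")
    case True
    then obtain j where j: "j \<in> I" "e j > m" by blast
    then have "(\<Sum>k\<in>I - {j}. max 0 (e k - m)) = 0"
      using one[of j] by (intro sum.neutral) force
    then show ?thesis using j le[of j] fin by (simp add: sum.remove[of I j])
  next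
    case False
    then have "(\<Sum>k\<in>I. max 0 (e k - m)) = 0" by (intro sum.neutral) force
    then show ?thesis using ml by simp
  qed
  finally show ?thesis by simp
qed

lemma mat_trace_eq_sum_eigenvalues:
  fixes A :: "real mat"
  assumes cols: "\<And>k. k < n \<Longrightarrow> (\<Sum>i<n. P i k * P i k) = 1"
    and entry: "\<And>i. i < n \<Longrightarrow> A $$ (i, i) = (\<Sum>k<n. e k * (P i k * P i k))"
  shows "(\<Sum>i<n. A $$ (i, i)) = (\<Sum>k<n. e k)"
proof -
  have "(\<Sum>i<n. A $$ (i, i)) = (\<Sum>i<n. \<Sum>k<n. e k * (P i k * P i k))"
    by (intro sum.cong) (simp_all add: entry)
  also have "\<dots> = (\<Sum>k<n. e k * (\<Sum>i<n. P i k * P i k))"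
    by (subst sum.swap) (simp add: sum_distrib_left)
  finally show ?thesis by (simp add: cols)
qed

text \<open>In orthonormal eigenvector coordinates \<open>y\<close>, the quadratic form minus
  \<open>m\<close> times the squared norm is the sum of \<open>(e k - m) * (y k)\<^sup>2\<close>,
  and every \<open>e k - m\<close> is at most half the total absolute deviation. No largest
  eigenvalue has to be singled out.\<close>

lemma eigenvalue_deviation_ge:
  fixes A :: "real mat" and x :: "nat \<Rightarrow> real"
  assumes A: "A \<in> carrier_mat n n" and sym: "transpose_mat A = A"
    and trace: "(\<Sum>i<n. A $$ (i, i)) = real n * m"
    and pos: "(\<Sum>i<n. (x i)\<^sup>2) > 0"
  shows "2 * ((\<Sum>i<n. \<Sum>j<n. A $$ (i, j) * (x i * x j)) - m * (\<Sum>i<n. (x i)\<^sup>2))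
      \<le> (\<Sum>\<mu>\<in>#proots (char_poly A). \<bar>\<mu> - m\<bar>) * (\<Sum>i<n. (x i)\<^sup>2)"
proof -
  obtain P e where cols: "\<And>j k. j < n \<Longrightarrow> k < n \<Longrightarrow> (\<Sum>i<n. P i j * P i k) = of_bool (j = k)"
    and rows: "\<And>i j. i < n \<Longrightarrow> j < n \<Longrightarrow> (\<Sum>k<n. P i k * P j k) = of_bool (i = j)"
    and entry: "\<And>i j. i < n \<Longrightarrow> j < n \<Longrightarrow> A $$ (i, j) = (\<Sum>k<n. e k * (P i k * P j k))"
    and eig: "\<And>k. k < n \<Longrightarrow> eigenfun A n (\<lambda>i. P i k) (e k)"
    and roots: "proots (char_poly A) = image_mset e (mset_set {..<n})"
    by (rule real_spectral_entries[OF A sym]) (rule that; simp)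
  define y where "y k = (\<Sum>i<n. P i k * x i)" for k
  have y2: "(y k)\<^sup>2 = (\<Sum>i<n. \<Sum>j<n. (P i k * P j k) * (x i * x j))" for k
    by (simp add: y_def power2_eq_square sum_product mult_ac)
  \<comment> \<open>Used twice: the weights \<open>e\<close> give the quadratic form, the weights 1
    give the squared norm.\<close>
  have weighted: "(\<Sum>k<n. w k * (y k)\<^sup>2)
      = (\<Sum>i<n. \<Sum>j<n. (\<Sum>k<n. w k * (P i k * P j k)) * (x i * x j))" for w
  proof -
    have "(\<Sum>k<n. w k * (y k)\<^sup>2) = (\<Sum>k<n. \<Sum>i<n. \<Sum>j<n. w k * (P i k * P j k) * (x i * x j))"
      by (simp add: y2 sum_distrib_left mult_ac)
    also have "\<dots> = (\<Sum>i<n. \<Sum>k<n. \<Sum>j<n. w k * (P i k * P j k) * (x i * x j))"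
      by (rule sum.swap)
    also have "\<dots> = (\<Sum>i<n. \<Sum>j<n. \<Sum>k<n. w k * (P i k * P j k) * (x i * x j))"
      by (intro sum.cong refl sum.swap)
    finally show ?thesis by (simp add: sum_distrib_right)
  qed
  have Q: "(\<Sum>i<n. \<Sum>j<n. A $$ (i, j) * (x i * x j)) = (\<Sum>k<n. e k * (y k)\<^sup>2)"
    unfolding weighted by (intro sum.cong refl) (simp add: entry)
  have "(\<Sum>k<n. 1 * (y k)\<^sup>2) = (\<Sum>i<n. \<Sum>j<n. if i = j then x i * x j else 0)"
    unfolding weighted by (intro sum.cong refl) (simp add: rows)
  then have N: "(\<Sum>i<n. (x i)\<^sup>2) = (\<Sum>k<n. (y k)\<^sup>2)" by (simp add: power2_eq_square)
  have tr: "sum e {..<n} = real (card {..<n}) * m"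
    using mat_trace_eq_sum_eigenvalues[of n P A e] cols entry trace by simp
  let ?E = "\<Sum>k<n. \<bar>e k - m\<bar>"
  have "2 * (e k - m) * (y k)\<^sup>2 \<le> ?E * (y k)\<^sup>2" if "k < n" for k
    using sum_abs_deviation_ge[OF _ _ tr, of k] that by (intro mult_right_mono) auto
  then have "(\<Sum>k<n. 2 * (e k - m) * (y k)\<^sup>2) \<le> (\<Sum>k<n. ?E * (y k)\<^sup>2)"
    by (intro sum_mono) simp
  then show ?thesis
    unfolding Q N roots
    by (simp add: image_mset.compositionality o_def sum_unfold_sum_mset[symmetric] algebra_simps
        sum_subtractf sum_distrib_left)
qed

text \<open>Distinct members of an orthonormal eigenbasis are orthogonal, so \<open>one\<close>
  leaves at most one of them with eigenvalue above \<open>m\<close>. Speaking of eigenfunctions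
  rather than eigenvalues accounts for multiplicities.\<close>

lemma eigenvalue_deviation_le:
  fixes A :: "real mat"
  assumes A: "A \<in> carrier_mat n n" and sym: "transpose_mat A = A"
    and trace: "(\<Sum>i<n. A $$ (i, i)) = real n * m" and ml: "m \<le> l"
    and one: "\<And>x y \<mu> \<nu>. eigenfun A n x \<mu> \<Longrightarrow> eigenfun A n y \<nu> \<Longrightarrow> m < \<mu> \<Longrightarrow> m < \<nu>
      \<Longrightarrow> (\<Sum>i<n. x i * y i) \<noteq> 0"
    and le: "\<And>x \<mu>. eigenfun A n x \<mu> \<Longrightarrow> m < \<mu> \<Longrightarrow> \<mu> \<le> l"
  shows "(\<Sum>\<mu>\<in>#proots (char_poly A). \<bar>\<mu> - m\<bar>) \<le> 2 * (l - m)"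
proof -
  obtain P e where cols: "\<And>j k. j < n \<Longrightarrow> k < n \<Longrightarrow> (\<Sum>i<n. P i j * P i k) = of_bool (j = k)"
    and rows: "\<And>i j. i < n \<Longrightarrow> j < n \<Longrightarrow> (\<Sum>k<n. P i k * P j k) = of_bool (i = j)"
    and entry: "\<And>i j. i < n \<Longrightarrow> j < n \<Longrightarrow> A $$ (i, j) = (\<Sum>k<n. e k * (P i k * P j k))"
    and eig: "\<And>k. k < n \<Longrightarrow> eigenfun A n (\<lambda>i. P i k) (e k)"
    and roots: "proots (char_poly A) = image_mset e (mset_set {..<n})"
    by (rule real_spectral_entries[OF A sym]) (rule that; simp)
  have tr: "sum e {..<n} = real (card {..<n}) * m"
    using mat_trace_eq_sum_eigenvalues[of n P A e] cols entry trace by simp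
  have "(\<Sum>k<n. \<bar>e k - m\<bar>) \<le> 2 * (l - m)"
  proof (rule sum_abs_deviation_le[OF _ tr ml])
    show "j = k" if "j \<in> {..<n}" "k \<in> {..<n}" "m < e j" "m < e k" for j k
      using one[OF eig eig, of j k] cols[of j k] that by auto
    show "e k \<le> l" if "k \<in> {..<n}" "m < e k" for k
      using le[OF eig, of k] that by auto
  qed simp
  then show ?thesis
    unfolding roots
    by (simp add: image_mset.compositionality o_def sum_unfold_sum_mset[symmetric])
qed

section \<open>Distances in trees\<close>

lemma is_path_Cons:
  "is_path V E (x # p) \<longleftrightarrow>
     x \<in> V \<and> x \<notin> set p \<and> (p = [] \<or> is_path V E p \<and> {x, hd p} \<in> E)"
  by (cases p) (auto simp: is_path_def)

lemma is_path_rev: "is_path V E (rev p) \<longleftrightarrow> is_path V E p"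
  by (auto simp: is_path_def successively_rev insert_commute)

lemma is_path_appendD:
  assumes "is_path V E (p @ q)"
  shows "p \<noteq> [] \<Longrightarrow> is_path V E p" and "q \<noteq> [] \<Longrightarrow> is_path V E q"
  using assms by (auto simp: is_path_def successively_append_iff)

lemma is_path_append:
  assumes "is_path V E p" and "is_path V E q" and "set p \<inter> set q = {}"
    and "{last p, hd q} \<in> E"
  shows "is_path V E (p @ q)"
  using assms by (auto simp: is_path_def successively_append_iff)

text \<open>Two paths that part at their common first vertex close a cycle where the first one
  meets the second one again.\<close>

lemma acyclic_path_unique:
  assumes "\<nexists>c. is_cycle V E c"
    and "is_path V E p" and "is_path V E q" and "hd p = hd q" and "last p = last q"
  shows "p = q"
  using assms(2-)
proof (induction p arbitrary: q)
  case Nil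
  then show ?case by (simp add: is_path_def)
next
  case (Cons x p q)
  obtain q' where q: "q = x # q'"
    using Cons.prems by (cases q) (auto simp: is_path_def)
  show ?case
  proof (cases "p = [] \<or> q' = []")
    case True
    then show ?thesis using Cons.prems unfolding q by (auto simp: is_path_Cons split: if_splits)
  next
    case False
    have p': "is_path V E p" "x \<notin> set p" "{x, hd p} \<in> E"
      and q': "is_path V E q'" "x \<notin> set q'" "{x, hd q'} \<in> E" and x: "x \<in> V"
      using Cons.prems(1,2) False unfolding q is_path_Cons by auto
    have l: "last p = last q'" using Cons.prems(4) False by (simp add: q)
    have "hd p = hd q'"
    proof (rule ccontr)
      assume neq: "hd p \<noteq> hd q'"
      have "\<exists>y\<in>set p. y \<in> set q'" using l False by (metis last_in_set)
      \<comment> \<open>\<open>y\<close> is the first vertex of \<open>p\<close> on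
        \<open>q'\<close>. Hence \<open>p1\<close> avoids \<open>q'\<close>, and following
        \<open>p1\<close> to \<open>y\<close> and then \<open>q1\<close> backwards repeats no
        vertex.\<close>
      then obtain p1 y p2 where p1: "p = p1 @ y # p2" "y \<in> set q'" "\<forall>z\<in>set p1. z \<notin> set q'"
        by (elim split_list_first_propE)
      obtain q1 q2 where q1: "q' = q1 @ y # q2" using p1(2) by (meson split_list)
      have a: "is_path V E (p1 @ [y])" using is_path_appendD(1)[of V E "p1 @ [y]" p2] p'(1) p1 by simp
      have "is_path V E (q1 @ [y])" using is_path_appendD(1)[of V E "q1 @ [y]" q2] q'(1) q1 by simp
      then have b: "is_path V E (y # rev q1)" using is_path_rev[of V E "q1 @ [y]"] by simp
      have "is_path V E (p1 @ y # rev q1)"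
      proof (cases "p1 = []")
        case False
        then show ?thesis
          using a b p1(3) q1 by (intro is_path_append) (auto simp: is_path_def successively_append_iff)
      qed (use b in simp)
      moreover have "hd (p1 @ y # rev q1) = hd p" by (cases p1) (simp_all add: p1)
      ultimately have path: "is_path V E (x # p1 @ y # rev q1)"
        unfolding is_path_Cons[of _ _ x] using x p' q' p1 q1 by auto
      moreover have "last (x # p1 @ y # rev q1) = hd q'"
        by (cases q1) (auto simp: q1)
      \<comment> \<open>The heads differ, so \<open>p1\<close> and \<open>q1\<close> are not both
        empty; this excludes a closed walk on only two vertices.\<close>
      moreover have "length (x # p1 @ y # rev q1) \<ge> 3"
        using neq by (cases p1; cases q1) (auto simp: p1 q1)
      ultimately have "is_cycle V E (x # p1 @ y # rev q1)"
        using q'(3) by (simp add: is_cycle_def insert_commute)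
      then show False using assms(1) by blast
    qed
    then show ?thesis using Cons.IH[OF p'(1) q'(1) _ l] by (simp add: q)
  qed
qed

section \<open>Distances and parents in a tree\<close>

locale tree =
  fixes V :: "'a set" and E :: "'a set set"
  assumes tree: "is_tree V E"
begin

abbreviation d :: "'a \<Rightarrow> 'a \<Rightarrow> nat" where "d \<equiv> graph_dist V E"
abbreviation joins :: "'a \<Rightarrow> 'a list \<Rightarrow> 'a \<Rightarrow> bool" where "joins \<equiv> path_between V E"

lemma finite_V: "finite V" and V_nonempty: "V \<noteq> {}"
  using tree by (auto simp: is_tree_def connected_graph_def simple_graph_def)

lemma real_card_remove:
  assumes "c \<in> V" shows "real (card (V - {c})) = real (card V) - 1"
proof -
  have "card V > 0" using assms finite_V by (auto simp: card_gt_0_iff)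
  then show ?thesis using assms finite_V by (simp add: of_nat_diff)
qed

lemma edge_subset: "e \<in> E \<Longrightarrow> e \<subseteq> V" and edge_card: "e \<in> E \<Longrightarrow> card e = 2"
  using tree by (auto simp: is_tree_def connected_graph_def simple_graph_def)

lemma edge_ends: "{x, y} \<in> E \<Longrightarrow> x \<in> V \<and> y \<in> V \<and> x \<noteq> y"
  using edge_subset[of "{x, y}"] edge_card[of "{x, y}"] by (cases "x = y") auto

lemma joins_exists: "u \<in> V \<Longrightarrow> v \<in> V \<Longrightarrow> \<exists>p. joins u p v"
  using tree by (auto simp: is_tree_def connected_graph_def)

lemma joins_unique: "joins u p v \<Longrightarrow> joins u q v \<Longrightarrow> p = q"
  using acyclic_path_unique[of V E p q] tree by (auto simp: is_tree_def path_between_def)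

text \<open>Uniqueness of paths leaves a single length for the minimum in \<open>graph_dist\<close>
  to range over, so distances can be read off from any path.\<close>

lemma dist_joins: "joins u p v \<Longrightarrow> d u v = length p - 1"
  unfolding graph_dist_def by (rule Least_equality) (auto dest: joins_unique)

lemma joins_single: "u \<in> V \<Longrightarrow> joins u [u] u"
  by (auto simp: path_between_def is_path_def)

lemma joins_edge: "{u, v} \<in> E \<Longrightarrow> joins u [u, v] v"
  using edge_ends[of u v] by (auto simp: path_between_def is_path_def)

lemma joins_prefix: "joins u (p @ w # q) v \<Longrightarrow> joins u (p @ [w]) w"
  using is_path_appendD(1)[of V E "p @ [w]" q]
  by (cases p) (auto simp: path_between_def)

lemma dist_self: "u \<in> V \<Longrightarrow> d u u = 0"
  using dist_joins[OF joins_single] by simp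

lemma dist_edge: "{u, v} \<in> E \<Longrightarrow> d u v = 1"
  using dist_joins[OF joins_edge] by simp

lemma dist_sym:
  assumes "u \<in> V" "v \<in> V" shows "d u v = d v u"
proof -
  obtain p where p: "joins u p v" using joins_exists[OF assms] by blast
  then have "joins v (rev p) u"
    by (auto simp: path_between_def is_path_rev hd_rev last_rev)
  then show ?thesis using p by (simp add: dist_joins)
qed

lemma dist_pos:
  assumes "u \<in> V" "v \<in> V" "u \<noteq> v" shows "d u v \<ge> 1"
proof -
  obtain p where p: "joins u p v" using joins_exists[OF assms(1,2)] by blast
  then have "length p \<ge> 2" using assms(3)
    by (cases p; cases "tl p") (auto simp: path_between_def is_path_def)
  then show ?thesis using p by (simp add: dist_joins)
qed

lemma dist_one_edge:
  assumes "u \<in> V" "v \<in> V" "d u v = 1" shows "{u, v} \<in> E"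
proof -
  obtain p where p: "joins u p v" using joins_exists[OF assms(1,2)] by blast
  then have "length p = 2" using assms(3) by (simp add: dist_joins)
  then obtain x y where "p = [x, y]" by (auto simp: numeral_2_eq_2 length_Suc_conv)
  then show ?thesis using p by (auto simp: path_between_def is_path_def)
qed

text \<open>The parent of \<open>v\<close> when the tree is rooted at \<open>c\<close>; for
  \<open>v = c\<close> the path is \<open>[c]\<close> and the value is an unspecified
  default.\<close>

definition parent :: "'a \<Rightarrow> 'a \<Rightarrow> 'a" where
  "parent c v = last (butlast (THE p. joins c p v))"

lemma parent_joins: "joins c (p @ [v]) v \<Longrightarrow> parent c v = last p"
  unfolding parent_def by (subst the_equality[of _ "p @ [v]"]) (auto dest: joins_unique)

lemma parent_properties:
  assumes "c \<in> V" "v \<in> V" "v \<noteq> c"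
  shows "{parent c v, v} \<in> E" and "d c v = d c (parent c v) + 1"
proof -
  obtain p where p: "joins c p v" using joins_exists[OF assms(1,2)] by blast
  then have "p = butlast p @ [v]"
    by (metis append_butlast_last_id is_path_def path_between_def)
  moreover have "butlast p \<noteq> []"
    using p assms(3) calculation by (cases "butlast p") (auto simp: path_between_def)
  ultimately obtain q w where q: "p = (q @ [w]) @ [v]" by (metis append_butlast_last_id)
  have w: "parent c v = w" using parent_joins[of c "q @ [w]" v] p q by simp
  have "joins c (q @ [w]) w" using joins_prefix[of c q w "[v]" v] p q by simp
  then show "d c v = d c (parent c v) + 1" using p q w by (simp add: dist_joins)
  show "{parent c v, v} \<in> E"
    using p unfolding q w path_between_def is_path_def by (simp add: successively_append_iff)
qed

text \<open>If the path from \<open>c\<close> to \<open>u\<close> avoids \<open>v\<close>, extending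
  it by \<open>v\<close> gives the path to \<open>v\<close>. Otherwise its part up to
  \<open>v\<close>, extended by \<open>u\<close>, is the path to \<open>u\<close>.\<close>

lemma edge_parent:
  assumes c: "c \<in> V" and uv: "{u, v} \<in> E"
  shows "v \<noteq> c \<and> u = parent c v \<or> u \<noteq> c \<and> v = parent c u"
proof -
  have V: "u \<in> V" "v \<in> V" "u \<noteq> v" using edge_ends[OF uv] by auto
  obtain p where p: "joins c p u" using joins_exists[OF c V(1)] by blast
  then have pn: "p \<noteq> []" "hd p = c" "last p = u" by (auto simp: path_between_def is_path_def)
  show ?thesis
  proof (cases "v \<in> set p")
    case False
    have "joins c (p @ [v]) v"
      using is_path_append[of V E p "[v]"] p False pn uv V
      by (auto simp: path_between_def is_path_Cons)
    moreover have "c \<in> set p" using pn by (metis hd_in_set)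
    ultimately show ?thesis using parent_joins[of c p v] False pn by auto
  next
    case True
    then obtain p1 p2 where p12: "p = p1 @ v # p2" by (meson split_list)
    have v: "joins c (p1 @ [v]) v" using joins_prefix p p12 by metis
    have "p2 \<noteq> []" using pn V p12 by auto
    then have "u \<notin> set (p1 @ [v])"
      using p pn V unfolding p12 path_between_def is_path_def by (auto dest: last_in_set)
    then have "joins c ((p1 @ [v]) @ [u]) u"
      using is_path_append[of V E "p1 @ [v]" "[u]"] v uv V
      by (auto simp: path_between_def is_path_Cons insert_commute hd_append)
    moreover have "c \<in> set (p1 @ [v])" using v unfolding path_between_def by (metis hd_in_set is_path_def)
    ultimately show ?thesis using parent_joins[of c "p1 @ [v]" u] \<open>u \<notin> set (p1 @ [v])\<close> by auto
  qed
qed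

section \<open>A lower bound for the distances avoiding a branch vertex\<close>

text \<open>Of two neighbours of \<open>c\<close>, one is not the second vertex of the path from
  \<open>c\<close> to \<open>v\<close>. As \<open>[c, w]\<close> is the only path from
  \<open>c\<close> to that neighbour \<open>w\<close>, the path to \<open>v\<close> misses
  \<open>w\<close> altogether and can be prolonged backwards to start at \<open>w\<close>.\<close>

lemma far_neighbour:
  assumes c: "{c, w1} \<in> E" "{c, w2} \<in> E" "w1 \<noteq> w2" and v: "v \<in> V" "d c v \<ge> 2"
  shows "\<exists>w. {c, w} \<in> E \<and> d w v \<ge> 3"
proof -
  have cV: "c \<in> V" using edge_ends[OF c(1)] by simp
  obtain p where p: "joins c p v" using joins_exists[OF cV v(1)] by blast
  obtain w where w: "{c, w} \<in> E" "w \<noteq> p ! 1" using c by metis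
  have "w \<notin> set p"
  proof
    assume "w \<in> set p"
    then obtain p1 p2 where p12: "p = p1 @ w # p2" by (meson split_list)
    then have "joins c (p1 @ [w]) w" using joins_prefix p by metis
    then have "p1 @ [w] = [c, w]" using joins_edge[OF w(1)] by (rule joins_unique)
    then show False using w p12 by simp
  qed
  then have "joins w (w # p) v"
    using p w edge_ends[OF w(1)] by (auto simp: path_between_def is_path_Cons[of _ _ w] insert_commute)
       (auto simp: is_path_def)
  then have "d w v = length p" by (simp add: dist_joins)
  then show ?thesis using w v(2) p by (auto simp: dist_joins)
qed

text \<open>An edge \<open>{parent c v, v}\<close> avoiding \<open>c\<close> falls one short of distance 2. This is made up for by
  the pair of \<open>v\<close> and a neighbour of \<open>c\<close> off the path from \<open>c\<close> to \<open>v\<close>: its distance is at least 3.\<close>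

lemma sum_dist_avoiding:
  assumes c: "{c, w1} \<in> E" "{c, w2} \<in> E" "w1 \<noteq> w2"
  shows "(\<Sum>u\<in>V - {c}. \<Sum>v\<in>V - {c}. real (d u v)) \<ge> 2 * (real (card V) - 1) * (real (card V) - 2)"
proof -
  have cV: "c \<in> V" using edge_ends[OF c(1)] by simp
  define U where "U = V - {c}"
  \<comment> \<open>These are the vertices other than \<open>c\<close> whose edge to the parent
    avoids \<open>c\<close>.\<close>
  define B where "B = {v \<in> V. d c v \<ge> 2}"
  define far where "far v = (SOME w. {c, w} \<in> E \<and> d w v \<ge> 3)" for v
  have far: "{c, far v} \<in> E" "d (far v) v \<ge> 3" if "v \<in> B" for v
    using someI_ex[OF far_neighbour[OF c, of v]] that by (auto simp: far_def B_def)
  have far': "far v \<in> U" "d c (far v) = 1" if "v \<in> B" for v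
    using far(1)[OF that] edge_ends[of c "far v"] dist_edge[of c "far v"] by (auto simp: U_def)
  have BU: "B \<subseteq> U" using cV by (auto simp: B_def U_def dist_self)
  have par: "{parent c v, v} \<in> E" "d c v = d c (parent c v) + 1" if "v \<in> U" for v
    using parent_properties[OF cV] that by (auto simp: U_def)
  have par': "parent c v \<in> U" if "v \<in> B" for v
  proof -
    have v: "v \<in> U" using that BU by auto
    then have "d c (parent c v) \<ge> 1" using par(2)[OF v] that by (simp add: B_def)
    then show ?thesis using edge_ends[OF par(1)[OF v]] dist_self[OF cV] by (auto simp: U_def)
  qed
  \<comment> \<open>A redistribution of weight: each \<open>v\<close> in \<open>B\<close> takes one
    unit from the pair with its parent and gives it to the pair with its far neighbour, so summing
    over \<open>u\<close> yields zero. Corrected by \<open>g\<close> in both orders, the leaf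
    distances of a star become a lower bound for \<open>d\<close> with an unchanged total.\<close>
  define g where "g u v = (if v \<in> B then of_bool (u = far v) - of_bool (u = parent c v) else 0 :: real)" for u v
  have finU: "finite U" using finite_V by (simp add: U_def)
  have g0: "(\<Sum>u\<in>U. g u v) = 0" for v
    using finU far'(1)[of v] par'[of v]
    by (cases "v \<in> B") (simp_all add: g_def sum_subtractf of_bool_def)
  have le: "2 - 2 * of_bool (u = v) + g u v + g v u \<le> real (d u v)" if uv: "u \<in> U" "v \<in> U" for u v
  proof -
    have V: "u \<in> V" "v \<in> V" using uv by (auto simp: U_def)
    \<comment> \<open>A far neighbour is adjacent to \<open>c\<close> and hence outside
      \<open>B\<close>, so no pair is raised in both orders.\<close>
    have far_le: "d u v \<ge> 3 \<and> \<not> (u \<in> B)" if "v \<in> B" "u = far v" for u v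
      using far[OF that(1)] far'[OF that(1)] that by (auto simp: B_def)
    show ?thesis
    proof (cases "u = v")
      case True
      then show ?thesis using far(2)[of v] par(2)[of v] uv V by (auto simp: g_def dist_self)
    next
      case False
      show ?thesis
      proof (cases "d u v = 1")
        case True
        have "{u, v} \<in> E" using dist_one_edge[OF V True] .
        have nf: "\<not> (v \<in> B \<and> u = far v)" "\<not> (u \<in> B \<and> v = far u)"
          using far[of v] far[of u] True dist_sym[OF V] by auto
        \<comment> \<open>One end of the edge is the parent of the other. As the parent is not
          \<open>c\<close>, the child has depth at least 2 and its correction lowers the bound from
          2 to 1.\<close>
        have "v \<in> B \<and> u = parent c v \<or> u \<in> B \<and> v = parent c u"
          using edge_parent[OF cV \<open>{u, v} \<in> E\<close>] par(2)[OF uv(1)] par(2)[OF uv(2)]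
            dist_pos[OF cV V(1)] dist_pos[OF cV V(2)] uv by (auto simp: B_def U_def)
        then show ?thesis using nf False True by (auto simp: g_def)
      next
        case d: False
        have "d u v \<ge> 2" using d dist_pos[OF V False] by simp
        moreover have "d v u = d u v" using dist_sym V by simp
        moreover define p q where "p \<longleftrightarrow> v \<in> B \<and> u = far v" and "q \<longleftrightarrow> u \<in> B \<and> v = far u"
        ultimately have "p \<longrightarrow> d u v \<ge> 3 \<and> \<not> q" "q \<longrightarrow> d u v \<ge> 3"
          using far_le[of v u] far_le[of u v] by metis+
        then have "2 + of_bool p + of_bool q \<le> d u v"
          using \<open>d u v \<ge> 2\<close> by (cases p; cases q) simp_all
        then have "2 + of_bool p + of_bool q \<le> real (d u v)"
          by (cases p; cases q) simp_all
        moreover have "g u v \<le> of_bool p" "g v u \<le> of_bool q"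
          by (simp_all add: g_def p_def q_def)
        ultimately show ?thesis using False by simp
      qed
    qed
  qed
  have m: "real (card U) = real (card V) - 1" using real_card_remove[OF cV] by (simp add: U_def)
  have "(\<Sum>u\<in>U. \<Sum>v\<in>U. 2 - 2 * of_bool (u = v) + g u v + g v u)
      = (\<Sum>u\<in>U. \<Sum>v\<in>U. 2 - 2 * of_bool (u = v)) + (\<Sum>v\<in>U. \<Sum>u\<in>U. g u v) + (\<Sum>u\<in>U. \<Sum>v\<in>U. g v u)"
    unfolding sum.distrib by (subst sum.swap[of "\<lambda>u v. g u v"]) simp
  also have "\<dots> = (\<Sum>u\<in>U. \<Sum>v\<in>U. 2 - 2 * of_bool (u = v))" by (simp add: g0)
  also have "\<dots> = (\<Sum>u\<in>U. 2 * real (card U) - 2)"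
    using finU by (intro sum.cong) (auto simp: sum_subtractf sum_distrib_left[symmetric] of_bool_def)
  also have "\<dots> = 2 * (real (card V) - 1) * (real (card V) - 2)"
    by (simp add: m algebra_simps)
  finally have "2 * (real (card V) - 1) * (real (card V) - 2)
      = (\<Sum>u\<in>U. \<Sum>v\<in>U. 2 - 2 * of_bool (u = v) + g u v + g v u)" by simp
  also have "\<dots> \<le> (\<Sum>u\<in>U. \<Sum>v\<in>U. real (d u v))" by (intro sum_mono le)
  finally show ?thesis by (simp add: U_def)
qed

text \<open>Either an arbitrary \<open>c\<close> is adjacent to all other vertices, of which there
  are at least two, or the second vertex on the path from \<open>c\<close> to a non-neighbour has
  two neighbours on that path.\<close>

lemma branch_vertex:
  assumes "card V \<ge> 3"
  shows "\<exists>c w1 w2. {c, w1} \<in> E \<and> {c, w2} \<in> E \<and> w1 \<noteq> w2"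
proof -
  obtain c where c: "c \<in> V" using V_nonempty by auto
  show ?thesis
  proof (cases "\<forall>v\<in>V - {c}. {c, v} \<in> E")
    case True
    have "\<not> card (V - {c}) \<le> Suc 0" using assms c finite_V by simp
    then obtain x y where "x \<in> V - {c}" "y \<in> V - {c}" "x \<noteq> y"
      using card_le_Suc0_iff_eq[of "V - {c}"] finite_V by blast
    then show ?thesis using True by blast
  next
    case False
    then obtain v where v: "v \<in> V" "v \<noteq> c" "{c, v} \<notin> E" by auto
    obtain p where p: "joins c p v" using joins_exists[OF c v(1)] by blast
    then obtain q where "p = c # q" by (cases p) (auto simp: path_between_def is_path_def)
    then obtain x r where "p = c # x # r" using p v by (cases q) (auto simp: path_between_def)
    then obtain y r where "p = c # x # y # r" using p v
      by (cases r) (auto simp: path_between_def is_path_def)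
    then have "{x, c} \<in> E" "{x, y} \<in> E" "c \<noteq> y" using p
      by (auto simp: path_between_def is_path_def insert_commute)
    then show ?thesis by blast
  qed
qed

text \<open>For fewer than three vertices the right-hand side is zero and every vertex will
  do.\<close>

lemma central_vertex:
  "\<exists>c\<in>V. (\<Sum>u\<in>V - {c}. \<Sum>v\<in>V - {c}. real (d u v)) \<ge> 2 * (real (card V) - 1) * (real (card V) - 2)"
proof (cases "card V \<ge> 3")
  case True
  then obtain c w1 w2 where "{c, w1} \<in> E" "{c, w2} \<in> E" "w1 \<noteq> w2" using branch_vertex by blast
  then show ?thesis using sum_dist_avoiding edge_ends by blast
next
  case False
  have "card V > 0" using V_nonempty finite_V by (simp add: card_gt_0_iff)
  then have "(real (card V) - 1) * (real (card V) - 2) = 0" using False by (cases "card V = 1") auto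
  moreover obtain c where "c \<in> V" using V_nonempty by auto
  ultimately show ?thesis by (intro bexI[of _ c]) (auto simp: sum_nonneg mult.assoc)
qed

section \<open>Transmissions, with the star as the extremal case\<close>

lemma transmission_eq:
  assumes "c \<in> V" shows "transmission V E c = (\<Sum>u\<in>V - {c}. real (d u c))"
  using assms finite_V by (simp add: transmission_def sum.remove dist_self)

lemma transmission_excess:
  assumes c: "c \<in> V"
  shows "transmission V E c = real (card V) - 1 + (\<Sum>u\<in>V - {c}. real (d u c) - 1)"
  using real_card_remove[OF c] by (simp add: transmission_eq[OF c] sum_subtractf)

lemma transmission_ge:
  assumes c: "c \<in> V" shows "transmission V E c \<ge> real (card V) - 1"
proof -
  have "(\<Sum>u\<in>V - {c}. real (d u c) - 1) \<ge> 0"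
    using dist_pos[OF _ c] by (intro sum_nonneg) simp
  then show ?thesis using transmission_excess[OF c] by simp
qed

text \<open>All distances to \<open>c\<close> must be 1, so every other vertex is adjacent to
  \<open>c\<close> and has \<open>c\<close> as its parent. Every edge joins a vertex to its parent,
  which leaves no further edges.\<close>

lemma transmission_eq_star:
  assumes c: "c \<in> V" and eq: "transmission V E c = real (card V) - 1"
  shows "is_star V E"
proof -
  have "(\<Sum>u\<in>V - {c}. real (d u c) - 1) = 0"
    using eq transmission_excess[OF c] by simp
  moreover have "0 \<le> real (d u c) - 1" if "u \<in> V - {c}" for u
    using dist_pos[of u c] c that by simp
  ultimately have "\<forall>u\<in>V - {c}. real (d u c) - 1 = 0"
    using sum_nonneg_eq_0_iff[of "V - {c}" "\<lambda>u. real (d u c) - 1"] finite_V by blast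
  then have adj: "{c, v} \<in> E" if "v \<in> V - {c}" for v
    using dist_one_edge[of v c] that c by (auto simp: insert_commute)
  have par: "parent c v = c" if "v \<in> V - {c}" for v
    using edge_parent[OF c adj[OF that]] by auto
  have "\<exists>v\<in>V - {c}. e = {c, v}" if e: "e \<in> E" for e
  proof -
    obtain x y where xy: "e = {x, y}" using edge_card[OF e] by (auto simp: card_2_iff)
    note ends = edge_ends[of x y, folded xy, OF e]
    from edge_parent[OF c, of x y, folded xy, OF e] show ?thesis
      using par[of x] par[of y] ends xy by (auto simp: insert_commute)
  qed
  then have "E = {{c, v} |v. v \<in> V - {c}}" using adj by auto
  then show ?thesis using finite_V c by (auto simp: is_star_def)
qed

lemma star_dist:
  assumes c: "c \<in> V" and star: "E = {{c, v} |v. v \<in> V - {c}}"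
  shows "v \<in> V - {c} \<Longrightarrow> d c v = 1"
    and "u \<in> V - {c} \<Longrightarrow> v \<in> V - {c} \<Longrightarrow> u \<noteq> v \<Longrightarrow> d u v = 2"
proof -
  show "d c v = 1" if "v \<in> V - {c}" using that star by (intro dist_edge) auto
  assume uv: "u \<in> V - {c}" "v \<in> V - {c}" "u \<noteq> v"
  then have "{c, u} \<in> E" "{c, v} \<in> E" using star by auto
  then have "joins u [u, c, v] v"
    using uv c by (auto simp: path_between_def is_path_def insert_commute)
  then show "d u v = 2" by (simp add: dist_joins)
qed

end

section \<open>The generalized distance energy of a tree\<close>

locale enumerated_tree = tree V E for V :: "'a set" and E :: "'a set set" +
  fixes vs :: "'a list" and \<alpha> :: real
  assumes distinct_vs: "distinct vs" and set_vs: "set vs = V"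
    and alpha_pos: "0 < \<alpha>" and alpha_less_1: "\<alpha> < 1"
begin

abbreviation Tr :: "'a \<Rightarrow> real" where "Tr \<equiv> transmission V E"
abbreviation M :: "real mat" where "M \<equiv> gen_distance_matrix V E vs \<alpha>"
abbreviation N :: real where "N \<equiv> real (card V)"

definition mean :: real where "mean = 2 * \<alpha> * wiener_index V E / N"

text \<open>The eigenvector equation of \<open>M\<close> freed from the enumeration
  \<open>vs\<close>.\<close>

definition eigenfun_V :: "('a \<Rightarrow> real) \<Rightarrow> real \<Rightarrow> bool" where
  "eigenfun_V f \<mu> \<longleftrightarrow> (\<exists>v\<in>V. f v \<noteq> 0) \<and>
     (\<forall>v\<in>V. \<alpha> * Tr v * f v + (1 - \<alpha>) * (\<Sum>u\<in>V. real (d v u) * f u) = \<mu> * f v)"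

lemma card_V: "card V = length vs"
  using distinct_card[OF distinct_vs] set_vs by simp

lemma N_ge_1: "N \<ge> 1"
  using V_nonempty finite_V by (simp add: Suc_le_eq card_gt_0_iff)

lemma sum_vs: "(\<Sum>i<length vs. h (vs ! i)) = (\<Sum>v\<in>V. h v)"
  using sum.reindex_bij_betw[OF bij_betw_nth[OF distinct_vs refl refl], of h] set_vs by simp

lemma nth_in_V: "i < length vs \<Longrightarrow> vs ! i \<in> V"
  using set_vs by auto

lemma M_carrier: "M \<in> carrier_mat (length vs) (length vs)"
  by (simp add: gen_distance_matrix_def transmission_matrix_def distance_matrix_def)

lemma M_entry:
  "i < length vs \<Longrightarrow> j < length vs \<Longrightarrow>
    M $$ (i, j) = (if i = j then \<alpha> * Tr (vs ! i) else 0) + (1 - \<alpha>) * real (d (vs ! i) (vs ! j))"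
  by (simp add: gen_distance_matrix_def transmission_matrix_def distance_matrix_def)

lemma M_sym: "transpose_mat M = M"
proof (rule eq_matI)
  fix i j assume "i < dim_row M" "j < dim_col M"
  then show "transpose_mat M $$ (i, j) = M $$ (i, j)"
    using M_carrier dist_sym[OF nth_in_V nth_in_V, of i j] by (auto simp: M_entry)
qed (use M_carrier in auto)

text \<open>Distances vanish on the diagonal, so the trace is \<open>\<alpha>\<close> times the sum
  of all transmissions. This makes \<open>mean\<close> the average of the eigenvalues.\<close>

lemma M_trace: "(\<Sum>i<length vs. M $$ (i, i)) = real (length vs) * mean"
proof -
  have "(\<Sum>i<length vs. M $$ (i, i)) = (\<Sum>i<length vs. \<alpha> * Tr (vs ! i))"
    by (intro sum.cong) (simp_all add: M_entry dist_self nth_in_V)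
  also have "\<dots> = (\<Sum>v\<in>V. \<alpha> * Tr v)" by (rule sum_vs)
  finally show ?thesis
    using N_ge_1 by (auto simp: mean_def wiener_index_def card_V simp flip: sum_distrib_left)
qed

lemma M_row:
  assumes "i < length vs"
  shows "(\<Sum>j<length vs. M $$ (i, j) * h (vs ! j))
    = \<alpha> * Tr (vs ! i) * h (vs ! i) + (1 - \<alpha>) * (\<Sum>u\<in>V. real (d (vs ! i) u) * h u)"
proof -
  have "(\<Sum>j<length vs. M $$ (i, j) * h (vs ! j))
      = (\<Sum>j<length vs. (if j = i then \<alpha> * Tr (vs ! i) * h (vs ! i) else 0)
          + (1 - \<alpha>) * (real (d (vs ! i) (vs ! j)) * h (vs ! j)))"
    using assms by (intro sum.cong) (simp_all add: M_entry algebra_simps)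
  also have "\<dots> = \<alpha> * Tr (vs ! i) * h (vs ! i)
      + (1 - \<alpha>) * (\<Sum>j<length vs. real (d (vs ! i) (vs ! j)) * h (vs ! j))"
    using assms by (simp add: sum.distrib sum_distrib_left)
  finally show ?thesis using sum_vs[of "\<lambda>u. real (d (vs ! i) u) * h u"] by simp
qed

lemma energy_eq: "gen_distance_energy V E vs \<alpha> = (\<Sum>\<mu>\<in>#proots (char_poly M). \<bar>\<mu> - mean\<bar>)"
  by (simp add: gen_distance_energy_def gen_distance_eigenvalues_def mean_def)

lemma energy_ge:
  assumes "(\<Sum>v\<in>V. (f v)\<^sup>2) > 0"
  shows "2 * (\<alpha> * (\<Sum>v\<in>V. Tr v * (f v)\<^sup>2) + (1 - \<alpha>) * (\<Sum>v\<in>V. \<Sum>u\<in>V. real (d v u) * f v * f u)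
       - mean * (\<Sum>v\<in>V. (f v)\<^sup>2))
    \<le> gen_distance_energy V E vs \<alpha> * (\<Sum>v\<in>V. (f v)\<^sup>2)"
proof -
  let ?n = "length vs"
  have sq: "(\<Sum>i<?n. (f (vs ! i))\<^sup>2) = (\<Sum>v\<in>V. (f v)\<^sup>2)" by (rule sum_vs)
  have "(\<Sum>i<?n. \<Sum>j<?n. M $$ (i, j) * (f (vs ! i) * f (vs ! j)))
      = (\<Sum>i<?n. f (vs ! i) * (\<Sum>j<?n. M $$ (i, j) * f (vs ! j)))"
    by (simp add: sum_distrib_left mult_ac)
  also have "\<dots> = (\<Sum>i<?n. f (vs ! i) *
      (\<alpha> * Tr (vs ! i) * f (vs ! i) + (1 - \<alpha>) * (\<Sum>u\<in>V. real (d (vs ! i) u) * f u)))"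
    by (intro sum.cong refl) (simp add: M_row)
  also have "\<dots> = (\<Sum>v\<in>V. f v * (\<alpha> * Tr v * f v + (1 - \<alpha>) * (\<Sum>u\<in>V. real (d v u) * f u)))"
    by (rule sum_vs)
  also have "\<dots> = \<alpha> * (\<Sum>v\<in>V. Tr v * (f v)\<^sup>2) + (1 - \<alpha>) * (\<Sum>v\<in>V. \<Sum>u\<in>V. real (d v u) * f v * f u)"
    by (simp add: distrib_left sum.distrib sum_distrib_left power2_eq_square mult_ac)
  finally show ?thesis
    using eigenvalue_deviation_ge[OF M_carrier M_sym M_trace, of "\<lambda>i. f (vs ! i)"] assms
    unfolding energy_eq sq by simp
qed

text \<open>Composing with the inverse \<open>idx\<close> of the enumeration turns eigenfunctions on
  indices into eigenfunctions on vertices and preserves inner products.\<close>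

lemma energy_le:
  assumes "mean \<le> l"
    and one: "\<And>f g \<mu> \<nu>. eigenfun_V f \<mu> \<Longrightarrow> eigenfun_V g \<nu> \<Longrightarrow> mean < \<mu> \<Longrightarrow> mean < \<nu>
      \<Longrightarrow> (\<Sum>v\<in>V. f v * g v) \<noteq> 0"
    and le: "\<And>f \<mu>. eigenfun_V f \<mu> \<Longrightarrow> mean < \<mu> \<Longrightarrow> \<mu> \<le> l"
  shows "gen_distance_energy V E vs \<alpha> \<le> 2 * (l - mean)"
proof -
  define idx where "idx = inv_into {..<length vs} ((!) vs)"
  have inj: "inj_on ((!) vs) {..<length vs}"
    using bij_betw_nth[OF distinct_vs refl refl] by (simp add: bij_betw_def)
  have idx: "idx (vs ! i) = i" if "i < length vs" for i
    unfolding idx_def by (rule inv_into_f_f[OF inj]) (use that in simp)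
  have pull: "eigenfun_V (\<lambda>v. x (idx v)) \<mu>" if "eigenfun M (length vs) x \<mu>" for x \<mu>
    unfolding eigenfun_V_def
  proof (intro conjI ballI)
    show "\<exists>v\<in>V. x (idx v) \<noteq> 0"
      using that nth_in_V idx unfolding eigenfun_def by force
    fix v assume "v \<in> V"
    then obtain i where i: "i < length vs" "v = vs ! i"
      using set_vs by (metis in_set_conv_nth)
    have "(\<Sum>j<length vs. M $$ (i, j) * x (idx (vs ! j))) = (\<Sum>j<length vs. M $$ (i, j) * x j)"
      by (intro sum.cong refl) (simp add: idx)
    also have "\<dots> = \<mu> * x i" using that i by (simp add: eigenfun_def)
    finally show "\<alpha> * Tr v * x (idx v) + (1 - \<alpha>) * (\<Sum>u\<in>V. real (d v u) * x (idx u)) = \<mu> * x (idx v)"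
      using M_row[OF i(1), of "\<lambda>v. x (idx v)"] i idx by simp
  qed
  show ?thesis
    unfolding energy_eq
  proof (rule eigenvalue_deviation_le[OF M_carrier M_sym M_trace assms(1)])
    fix x y \<mu> \<nu>
    assume "eigenfun M (length vs) x \<mu>" "eigenfun M (length vs) y \<nu>" "mean < \<mu>" "mean < \<nu>"
    then have "(\<Sum>v\<in>V. x (idx v) * y (idx v)) \<noteq> 0" by (intro one pull)
    moreover have "(\<Sum>i<length vs. x (idx (vs ! i)) * y (idx (vs ! i))) = (\<Sum>i<length vs. x i * y i)"
      by (intro sum.cong refl) (simp add: idx)
    ultimately show "(\<Sum>i<length vs. x i * y i) \<noteq> 0"
      using sum_vs[of "\<lambda>v. x (idx v) * y (idx v)"] by simp
  qed (use le pull in blast)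
qed

section \<open>The quadratic equation for the largest eigenvalue of the star\<close>

text \<open>This is the \<open>k\<close> of the theorem, and the discriminant of the quadratic in
  \<open>star_root_product\<close>.\<close>

definition disc :: real where
  "disc = (N ^ 2 - 2 * N + 2) * (\<alpha> - 2) ^ 2 + 2 * (N - 1) * (\<alpha> ^ 2 - 2)"

text \<open>The largest eigenvalue of the star of the same order; \<open>star_root - (2 * N - 4 + \<alpha>)\<close> and
  \<open>1 - \<alpha>\<close> are the values of its Perron vector at the centre and at the leaves.\<close>

definition star_root :: real where "star_root = (\<alpha> * N + 2 * N - 4 + sqrt disc) / 2"

lemma disc_eq: "disc = ((N - 2) * (2 - \<alpha>))\<^sup>2 + 4 * (1 - \<alpha>)\<^sup>2 * (N - 1)"
  by (simp add: disc_def power2_eq_square algebra_simps)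

lemma disc_nonneg: "disc \<ge> 0"
  using N_ge_1 by (simp add: disc_eq)

text \<open>The characteristic equation of the quotient matrix of the star for the partition into
  centre and leaves; its diagonal entries are \<open>\<alpha> * (N - 1)\<close> and
  \<open>2 * N - 4 + \<alpha>\<close>.\<close>

lemma star_root_product: "(star_root - \<alpha> * (N - 1)) * (star_root - (2 * N - 4 + \<alpha>)) = (1 - \<alpha>)\<^sup>2 * (N - 1)"
proof -
  have "(star_root - \<alpha> * (N - 1)) * (star_root - (2 * N - 4 + \<alpha>))
      = ((sqrt disc)\<^sup>2 - ((N - 2) * (2 - \<alpha>))\<^sup>2) / 4"
    by (simp add: star_root_def power2_eq_square field_simps)
  then show ?thesis using disc_nonneg by (simp add: disc_eq)
qed

text \<open>Makes the central value of the test vector positive. For \<open>N = 1\<close> the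
  product in \<open>star_root_product\<close> is zero, and the sign of \<open>N - 2\<close> decides
  instead.\<close>

lemma star_root_gt: "star_root > 2 * N - 4 + \<alpha>"
proof -
  have "star_root - (2 * N - 4 + \<alpha>) = (sqrt disc - (N - 2) * (2 - \<alpha>)) / 2"
    by (simp add: star_root_def field_simps)
  moreover have "(N - 2) * (2 - \<alpha>) < sqrt disc"
  proof (cases "N = 1")
    case True
    have "(N - 2) * (2 - \<alpha>) < 0" using True alpha_less_1 by simp
    then show ?thesis using disc_nonneg by (meson less_le_trans real_sqrt_ge_zero)
  next
    case False
    then have "4 * (1 - \<alpha>)\<^sup>2 * (N - 1) > 0" using N_ge_1 alpha_less_1 by simp
    then show ?thesis by (intro real_less_rsqrt) (simp add: disc_eq)
  qed
  ultimately show ?thesis by simp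
qed

text \<open>The assumption is the value of \<open>mean\<close> for a star. From \<open>N = 2\<close>
  on, it is at most the leaf entry \<open>2 * N - 4 + \<alpha>\<close>; for \<open>N = 1\<close>
  both sides are zero.\<close>

lemma mean_le_star_root:
  assumes "mean = 2 * \<alpha> * (N - 1)\<^sup>2 / N" shows "mean \<le> star_root"
proof (cases "N = 1")
  case True
  then show ?thesis using assms alpha_less_1 by (simp add: star_root_def disc_def)
next
  case False
  then have "N \<ge> 2" using N_ge_1 by simp
  then have "0 \<le> (N - 2) * (2 * N - \<alpha> * (2 * N - 1))"
  proof -
    have "\<alpha> * (2 * N - 1) \<le> 1 * (2 * N - 1)"
      using alpha_less_1 \<open>N \<ge> 2\<close> by (intro mult_right_mono) auto
    then have "0 \<le> 2 * N - \<alpha> * (2 * N - 1)" by (simp add: algebra_simps)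
    then show ?thesis using \<open>N \<ge> 2\<close> by (intro mult_nonneg_nonneg) simp_all
  qed
  also have "\<dots> = (2 * N - 4 + \<alpha>) * N - 2 * \<alpha> * (N - 1)\<^sup>2"
    by (simp add: power2_eq_square algebra_simps)
  finally have "mean \<le> 2 * N - 4 + \<alpha>"
    using assms \<open>N \<ge> 2\<close> by (simp add: pos_divide_le_eq)
  then show ?thesis using star_root_gt by simp
qed

lemma sum_split:
  assumes "c \<in> V" shows "(\<Sum>v\<in>V. h v) = h c + (\<Sum>v\<in>V - {c}. h v :: real)"
  using assms finite_V by (simp add: sum.remove)

lemma transmission_sym: "c \<in> V \<Longrightarrow> (\<Sum>u\<in>V - {c}. real (d c u)) = Tr c"
  by (simp add: transmission_eq) (intro sum.cong refl, auto intro: dist_sym)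

section \<open>The lower bound by a Rayleigh quotient\<close>

text \<open>For the test function \<open>f\<close> the quadratic form of \<open>M\<close> is
  \<open>Tr c * q + ?R * b\<^sup>2\<close> with \<open>q > 0\<close>. It is smallest at the star
  values of \<open>Tr c\<close> and \<open>?R\<close>, where the quotient is
  \<open>star_root\<close>, and strictly larger once \<open>Tr c\<close> exceeds its star
  value.\<close>

lemma energy_ge_central:
  assumes c: "c \<in> V"
    and R: "(\<Sum>u\<in>V - {c}. \<Sum>v\<in>V - {c}. real (d u v)) \<ge> 2 * (N - 1) * (N - 2)"
  shows "gen_distance_energy V E vs \<alpha> \<ge> 2 * (star_root - mean)"
    and "Tr c > N - 1 \<Longrightarrow> gen_distance_energy V E vs \<alpha> > 2 * (star_root - mean)"
proof -
  let ?R = "\<Sum>u\<in>V - {c}. \<Sum>v\<in>V - {c}. real (d u v)"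
  define a where "a = star_root - (2 * N - 4 + \<alpha>)"
  define b where "b = 1 - \<alpha>"
  define f where "f v = (if v = c then a else b)" for v
  define q where "q = \<alpha> * a\<^sup>2 + \<alpha> * b\<^sup>2 + 2 * (1 - \<alpha>) * a * b"
  have a: "a > 0" and b: "b > 0" using star_root_gt alpha_less_1 by (simp_all add: a_def b_def)
  have fb: "f v = b" if "v \<in> V - {c}" for v using that by (simp add: f_def)
  have fc: "f c = a" by (simp add: f_def)
  have sq: "(\<Sum>v\<in>V. (f v)\<^sup>2) = a\<^sup>2 + (N - 1) * b\<^sup>2"
    using real_card_remove[OF c] by (simp add: sum_split[OF c] fc fb)
  have sq_pos: "a\<^sup>2 + (N - 1) * b\<^sup>2 > 0" using a N_ge_1 by (simp add: add_pos_nonneg)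
  have tr: "(\<Sum>v\<in>V - {c}. Tr v) = Tr c + ?R"
  proof -
    have "(\<Sum>v\<in>V - {c}. Tr v) = (\<Sum>v\<in>V - {c}. real (d c v) + (\<Sum>u\<in>V - {c}. real (d u v)))"
      by (simp add: transmission_def sum_split[OF c])
    also have "\<dots> = Tr c + (\<Sum>v\<in>V - {c}. \<Sum>u\<in>V - {c}. real (d u v))"
      by (simp add: sum.distrib transmission_sym[OF c])
    finally show ?thesis by (subst (asm) sum.swap)
  qed
  have q1: "(\<Sum>v\<in>V. Tr v * (f v)\<^sup>2) = Tr c * a\<^sup>2 + (Tr c + ?R) * b\<^sup>2"
    by (simp add: sum_split[OF c] fc fb tr flip: sum_distrib_right)
  have "(\<Sum>v\<in>V. \<Sum>u\<in>V. real (d v u) * f v * f u)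
      = (\<Sum>u\<in>V - {c}. real (d c u) * a * b)
        + (\<Sum>v\<in>V - {c}. real (d v c) * b * a + (\<Sum>u\<in>V - {c}. real (d v u) * b * b))"
    using dist_self[OF c] by (simp add: sum_split[OF c] fc fb)
  also have "\<dots> = Tr c * a * b + (Tr c * b * a + ?R * b * b)"
    by (simp add: sum.distrib transmission_eq[OF c] transmission_sym[OF c, unfolded transmission_eq[OF c]]
        flip: sum_distrib_right)
  finally have q2: "(\<Sum>v\<in>V. \<Sum>u\<in>V. real (d v u) * f v * f u) = 2 * Tr c * a * b + ?R * b\<^sup>2"
    by (simp add: power2_eq_square)
  have "2 * (\<alpha> * (Tr c * a\<^sup>2 + (Tr c + ?R) * b\<^sup>2) + (1 - \<alpha>) * (2 * Tr c * a * b + ?R * b\<^sup>2)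
       - mean * (a\<^sup>2 + (N - 1) * b\<^sup>2))
    \<le> gen_distance_energy V E vs \<alpha> * (a\<^sup>2 + (N - 1) * b\<^sup>2)"
    using energy_ge[of f] sq_pos unfolding q1 q2 sq by simp
  moreover have "\<alpha> * (Tr c * a\<^sup>2 + (Tr c + ?R) * b\<^sup>2) + (1 - \<alpha>) * (2 * Tr c * a * b + ?R * b\<^sup>2)
      = Tr c * q + ?R * b\<^sup>2"
    by (simp add: q_def algebra_simps)
  ultimately have energy: "2 * (Tr c * q + ?R * b\<^sup>2 - mean * (a\<^sup>2 + (N - 1) * b\<^sup>2))
      \<le> gen_distance_energy V E vs \<alpha> * (a\<^sup>2 + (N - 1) * b\<^sup>2)" by simp
  \<comment> \<open>The two brackets are the eigenvector equations of the quotient matrix at the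
    centre and at a leaf: the first vanishes by \<open>star_root_product\<close>, the second by the
    choice of \<open>a\<close> and \<open>b\<close>.\<close>
  have "star_root * (a\<^sup>2 + (N - 1) * b\<^sup>2) - (N - 1) * q - 2 * (N - 1) * (N - 2) * b\<^sup>2
      = a * ((star_root - \<alpha> * (N - 1)) * a - (1 - \<alpha>) * (N - 1) * b)
        + (N - 1) * b * ((star_root - (2 * N - 4 + \<alpha>)) * b - (1 - \<alpha>) * a)"
    by (simp add: q_def power2_eq_square algebra_simps)
  also have "\<dots> = 0"
    using star_root_product by (simp add: a_def b_def power2_eq_square)
  finally have star: "star_root * (a\<^sup>2 + (N - 1) * b\<^sup>2) = (N - 1) * q + 2 * (N - 1) * (N - 2) * b\<^sup>2" by simp
  have q: "q > 0" using a b alpha_pos by (simp add: q_def add_pos_pos b_def)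
  have Rb: "2 * (N - 1) * (N - 2) * b\<^sup>2 \<le> ?R * b\<^sup>2" using R by (rule mult_right_mono) simp
  have "(N - 1) * q \<le> Tr c * q" using transmission_ge[OF c] q by simp
  then have "2 * (star_root - mean) * (a\<^sup>2 + (N - 1) * b\<^sup>2)
      \<le> gen_distance_energy V E vs \<alpha> * (a\<^sup>2 + (N - 1) * b\<^sup>2)"
    using energy star Rb by (simp add: algebra_simps)
  then show "gen_distance_energy V E vs \<alpha> \<ge> 2 * (star_root - mean)" using sq_pos by simp
  assume "Tr c > N - 1"
  then have "(N - 1) * q < Tr c * q" using q by simp
  then have "2 * (star_root - mean) * (a\<^sup>2 + (N - 1) * b\<^sup>2)
      < gen_distance_energy V E vs \<alpha> * (a\<^sup>2 + (N - 1) * b\<^sup>2)"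
    using energy star Rb by (simp add: algebra_simps)
  then show "gen_distance_energy V E vs \<alpha> > 2 * (star_root - mean)" using sq_pos by simp
qed

lemma energy_lower_bound:
  shows "gen_distance_energy V E vs \<alpha> \<ge> 2 * (star_root - mean)"
    and "\<not> is_star V E \<Longrightarrow> gen_distance_energy V E vs \<alpha> > 2 * (star_root - mean)"
proof -
  obtain c where c: "c \<in> V"
    "(\<Sum>u\<in>V - {c}. \<Sum>v\<in>V - {c}. real (d u v)) \<ge> 2 * (N - 1) * (N - 2)"
    using central_vertex by blast
  show "gen_distance_energy V E vs \<alpha> \<ge> 2 * (star_root - mean)" by (rule energy_ge_central[OF c])
  assume "\<not> is_star V E"
  then have "Tr c > N - 1"
    using transmission_ge[OF c(1)] transmission_eq_star[OF c(1)] by fastforce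
  then show "gen_distance_energy V E vs \<alpha> > 2 * (star_root - mean)" by (rule energy_ge_central(2)[OF c])
qed

section \<open>The spectrum of the star and the case of equality\<close>

context
  fixes c
  assumes c: "c \<in> V" and star: "E = {{c, v} |v. v \<in> V - {c}}"
begin

lemma star_sum_dist_centre: "(\<Sum>u\<in>V. real (d c u) * f u) = (\<Sum>u\<in>V - {c}. f u)"
  using star_dist(1)[OF c star] by (simp add: sum_split[OF c] dist_self[OF c])

lemma star_sum_dist_leaf:
  assumes v: "v \<in> V - {c}"
  shows "(\<Sum>u\<in>V. real (d v u) * f u) = f c + 2 * ((\<Sum>u\<in>V - {c}. f u) - f v)"
proof -
  have "(\<Sum>u\<in>V - {c} - {v}. real (d v u) * f u) = (\<Sum>u\<in>V - {c} - {v}. 2 * f u)"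
    by (intro sum.cong refl) (use star_dist(2)[OF c star v] in auto)
  then have "(\<Sum>u\<in>V - {c}. real (d v u) * f u) = (\<Sum>u\<in>V - {c} - {v}. 2 * f u)"
    using v finite_V dist_self[of v] by (simp add: sum.remove[of _ v])
  moreover have "d v c = 1" using star_dist(1)[OF c star v] dist_sym[of v c] v c by simp
  moreover have "(\<Sum>u\<in>V - {c}. f u) = f v + (\<Sum>u\<in>V - {c} - {v}. f u)"
    using v finite_V by (simp add: sum.remove)
  ultimately show ?thesis by (simp add: sum_split[OF c] sum_distrib_left)
qed

lemma star_Tr: "Tr c = N - 1" "v \<in> V - {c} \<Longrightarrow> Tr v = 2 * N - 3"
proof -
  show "Tr c = N - 1"
    using star_sum_dist_centre[of "\<lambda>_. 1"] real_card_remove[OF c] transmission_sym[OF c]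
    by (simp add: sum_split[OF c] dist_self[OF c])
  assume v: "v \<in> V - {c}"
  have "Tr v = (\<Sum>u\<in>V. real (d v u) * 1)"
    unfolding transmission_def using v by (intro sum.cong) (auto intro: dist_sym)
  then show "Tr v = 2 * N - 3"
    unfolding star_sum_dist_leaf[OF v] using real_card_remove[OF c] by simp
qed

lemma star_mean: "mean = 2 * \<alpha> * (N - 1)\<^sup>2 / N"
proof -
  have "(\<Sum>v\<in>V. Tr v) = (N - 1) + (N - 1) * (2 * N - 3)"
    using real_card_remove[OF c] by (simp add: sum_split[OF c] star_Tr)
  also have "\<dots> = 2 * (N - 1)\<^sup>2" by (simp add: power2_eq_square algebra_simps)
  finally show ?thesis by (simp add: mean_def wiener_index_def)
qed

text \<open>The differences of leaves span the eigenspace of \<open>\<alpha> * (2 * N - 1) - 2\<close>, which the bound on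
  \<open>\<alpha>\<close> keeps below the mean; hence all other eigenfunctions are constant on the leaves.\<close>

lemma star_eigenfun:
  assumes small: "\<alpha> < 2 * N / (3 * N - 2)"
    and eig: "eigenfun_V f \<mu>" and \<mu>: "mean < \<mu>"
  obtains b where "\<And>v. v \<in> V - {c} \<Longrightarrow> f v = b" and "f c * b > 0" and "N > 1"
    and "(\<mu> - \<alpha> * (N - 1)) * (\<mu> - (2 * N - 4 + \<alpha>)) = (1 - \<alpha>)\<^sup>2 * (N - 1)"
    and "\<mu> > \<alpha> * (N - 1)"
proof -
  define S where "S = (\<Sum>u\<in>V - {c}. f u)"
  have row: "\<alpha> * Tr v * f v + (1 - \<alpha>) * (\<Sum>u\<in>V. real (d v u) * f u) = \<mu> * f v" if "v \<in> V" for v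
    using eig that by (simp add: eigenfun_V_def)
  \<comment> \<open>Cleared of denominators, this is the inequality between the leaf-difference
    eigenvalue \<open>\<alpha> * (2 * N - 1) - 2\<close> and the mean.\<close>
  have "\<alpha> * (3 * N - 2) < 2 * N" using small N_ge_1 by (simp add: pos_less_divide_eq)
  then have "(\<alpha> * (2 * N - 1) - 2) * N < 2 * \<alpha> * (N - 1)\<^sup>2"
    by (simp add: power2_eq_square algebra_simps)
  then have "\<alpha> * (2 * N - 1) - 2 < mean"
    unfolding star_mean using N_ge_1 by (subst pos_less_divide_eq) auto
  then have leaf_gap: "\<mu> - (\<alpha> * (2 * N - 1) - 2) > 0" using \<mu> by simp
  have leaf_row: "\<alpha> * (2 * N - 3) * f v + (1 - \<alpha>) * (f c + 2 * (S - f v)) = \<mu> * f v"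
    if v: "v \<in> V - {c}" for v
    using row[of v] v star_Tr(2)[OF v] unfolding star_sum_dist_leaf[OF v] S_def by simp
  \<comment> \<open>Collecting the terms in \<open>f v\<close> of the leaf equation leaves a
    right-hand side that does not depend on \<open>v\<close>; \<open>b\<close> is its solution, the
    coefficient being positive.\<close>
  define b where "b = (1 - \<alpha>) * (f c + 2 * S) / (\<mu> - (\<alpha> * (2 * N - 1) - 2))"
  have fb: "f v = b" if v: "v \<in> V - {c}" for v
  proof -
    have "(\<mu> - (\<alpha> * (2 * N - 1) - 2)) * f v = (1 - \<alpha>) * (f c + 2 * S)"
      using leaf_row[OF v] by (simp add: algebra_simps)
    then show ?thesis using leaf_gap by (simp add: b_def field_simps)
  qed
  have S: "S = (N - 1) * b" using real_card_remove[OF c] by (simp add: S_def fb)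
  have "\<alpha> * (N - 1) * f c + (1 - \<alpha>) * S = \<mu> * f c"
    using row[OF c] unfolding star_sum_dist_centre star_Tr(1) S_def .
  then have centre: "(1 - \<alpha>) * (N - 1) * b = (\<mu> - \<alpha> * (N - 1)) * f c"
    by (simp add: S algebra_simps)
  \<comment> \<open>This makes the coefficient of \<open>f c\<close> in \<open>centre\<close>
    positive, which forces \<open>f c\<close> and \<open>b\<close> to have the same sign.\<close>
  have "\<alpha> * (N - 1) \<le> mean"
  proof (cases "N = 1")
    case False
    then have "N \<ge> 2" using N_ge_1 by simp
    then have "0 \<le> \<alpha> * (N - 1) * (N - 2)" using alpha_pos by simp
    then have "\<alpha> * (N - 1) * N \<le> 2 * \<alpha> * (N - 1)\<^sup>2"
      by (simp add: power2_eq_square algebra_simps)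
    then show ?thesis
      unfolding star_mean using \<open>N \<ge> 2\<close> by (subst pos_le_divide_eq) auto
  qed (simp add: star_mean)
  then have gap: "\<mu> - \<alpha> * (N - 1) > 0" using \<mu> by simp
  have N: "N > 1"
  proof (rule ccontr)
    assume "\<not> N > 1"
    then have "N = 1" using N_ge_1 by simp
    then have "f c = 0" using centre gap by simp
    moreover have "card (V - {c}) = 0" using real_card_remove[OF c] \<open>N = 1\<close> by simp
    ultimately show False using eig finite_V by (auto simp: eigenfun_V_def)
  qed
  have "f c \<noteq> 0"
  proof
    assume "f c = 0"
    then have "b = 0" using centre N alpha_less_1 by simp
    then show False using \<open>f c = 0\<close> fb eig by (auto simp: eigenfun_V_def)
  qed
  then have "(\<mu> - \<alpha> * (N - 1)) * f c * f c > 0"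
    using gap by (simp add: mult.assoc zero_less_mult_iff not_less)
      (use linorder_less_linear in blast)
  also have "(\<mu> - \<alpha> * (N - 1)) * f c * f c = ((1 - \<alpha>) * (N - 1)) * (f c * b)"
    unfolding centre[symmetric] by (simp add: mult_ac)
  finally have "((1 - \<alpha>) * (N - 1)) * (f c * b) > 0" .
  moreover have "(1 - \<alpha>) * (N - 1) > 0" using N alpha_less_1 by simp
  ultimately have pos: "f c * b > 0" by (simp only: zero_less_mult_pos)
  obtain v where v: "v \<in> V - {c}"
    using N real_card_remove[OF c] by (metis card.empty diff_gt_0_iff_gt ex_in_conv less_irrefl of_nat_0)
  have leaf: "(\<mu> - (2 * N - 4 + \<alpha>)) * b = (1 - \<alpha>) * f c"
    using leaf_row[OF v] by (simp add: fb[OF v] S algebra_simps)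
  \<comment> \<open>Multiplying the equations at the centre and at a leaf and cancelling
    \<open>f c * b\<close> gives the quadratic of \<open>star_root_product\<close> for
    \<open>\<mu>\<close>.\<close>
  have "((\<mu> - \<alpha> * (N - 1)) * (\<mu> - (2 * N - 4 + \<alpha>))) * (f c * b)
      = ((\<mu> - \<alpha> * (N - 1)) * f c) * ((\<mu> - (2 * N - 4 + \<alpha>)) * b)" by (simp add: mult_ac)
  also have "\<dots> = ((1 - \<alpha>)\<^sup>2 * (N - 1)) * (f c * b)"
    unfolding leaf centre[symmetric] by (simp add: power2_eq_square mult_ac)
  finally have "(\<mu> - \<alpha> * (N - 1)) * (\<mu> - (2 * N - 4 + \<alpha>)) = (1 - \<alpha>)\<^sup>2 * (N - 1)"
    using pos mult_right_cancel[of "f c * b"] by (metis less_irrefl)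
  moreover have "\<mu> > \<alpha> * (N - 1)" using gap by simp
  ultimately show ?thesis using that[OF fb pos N] by blast
qed

text \<open>By the common sign of centre and leaf values, the central and the leaf part of the inner
  product of two eigenfunctions above the mean have the same sign and cannot cancel. So only one
  eigenvalue lies above the mean, and the quadratic bounds it by \<open>star_root\<close>.\<close>

lemma star_energy_le:
  assumes small: "\<alpha> < 2 * N / (3 * N - 2)"
  shows "gen_distance_energy V E vs \<alpha> \<le> 2 * (star_root - mean)"
proof (rule energy_le)
  show "mean \<le> star_root" using star_mean by (rule mean_le_star_root)
next
  fix f g \<mu> \<nu> assume *: "eigenfun_V f \<mu>" "eigenfun_V g \<nu>" "mean < \<mu>" "mean < \<nu>"
  obtain b where b: "\<And>v. v \<in> V - {c} \<Longrightarrow> f v = b" "f c * b > 0" "N > 1"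
    using star_eigenfun[OF small *(1,3)] by metis
  obtain b' where b': "\<And>v. v \<in> V - {c} \<Longrightarrow> g v = b'" "g c * b' > 0"
    using star_eigenfun[OF small *(2,4)] by metis
  have eq: "(\<Sum>v\<in>V. f v * g v) = f c * g c + (N - 1) * (b * b')"
    using real_card_remove[OF c] by (simp add: sum_split[OF c] b(1) b'(1))
  have "(f c * g c) * (b * b') > 0" using mult_pos_pos[OF b(2) b'(2)] by (simp add: mult_ac)
  then have "f c * g c > 0 \<and> b * b' > 0 \<or> f c * g c < 0 \<and> b * b' < 0"
    by (simp add: zero_less_mult_iff)
  then show "(\<Sum>v\<in>V. f v * g v) \<noteq> 0"
  proof
    assume "f c * g c > 0 \<and> b * b' > 0"
    then have "f c * g c > 0" "(N - 1) * (b * b') > 0" using b(3) by simp_all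
    then show ?thesis unfolding eq by linarith
  next
    assume "f c * g c < 0 \<and> b * b' < 0"
    then have "f c * g c < 0" "(N - 1) * (b * b') < 0" using b(3) by (simp_all add: mult_pos_neg)
    then show ?thesis unfolding eq by linarith
  qed
next
  fix f \<mu> assume "eigenfun_V f \<mu>" "mean < \<mu>"
  then have N: "N > 1"
    and root: "(\<mu> - \<alpha> * (N - 1)) * (\<mu> - (2 * N - 4 + \<alpha>)) = (1 - \<alpha>)\<^sup>2 * (N - 1)"
    and gap: "\<mu> > \<alpha> * (N - 1)"
    using star_eigenfun[OF small] by metis+
  show "\<mu> \<le> star_root"
  proof (rule ccontr)
    assume "\<not> \<mu> \<le> star_root"
    moreover have "0 \<le> (star_root - \<alpha> * (N - 1)) * (star_root - (2 * N - 4 + \<alpha>))"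
      using N by (simp add: star_root_product)
    \<comment> \<open>To the right of both its zeros the product increases strictly, so a larger
      \<open>\<mu>\<close> could not give the same value.\<close>
    then have "star_root \<ge> \<alpha> * (N - 1)" using star_root_gt by (simp add: zero_le_mult_iff)
    ultimately have "(star_root - \<alpha> * (N - 1)) * (star_root - (2 * N - 4 + \<alpha>))
        < (\<mu> - \<alpha> * (N - 1)) * (\<mu> - (2 * N - 4 + \<alpha>))"
      using star_root_gt gap by (intro mult_strict_mono') auto
    then show False using root star_root_product by simp
  qed
qed

end

end

theorem theorem5p5:
  fixes V :: "'a set" and E :: "'a set set" and vs :: "'a list"
    and n :: nat and \<alpha> k :: real
  assumes "is_tree V E" and "card V = n"
    and "distinct vs" and "set vs = V"
    and "0 < \<alpha>" and "\<alpha> < 1"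
    and "k = (real n ^ 2 - 2 * real n + 2) * (\<alpha> - 2) ^ 2 + 2 * (real n - 1) * (\<alpha> ^ 2 - 2)"
  shows "gen_distance_energy V E vs \<alpha>
           \<ge> \<alpha> * real n + 2 * real n - 4 + sqrt k - 4 * \<alpha> * wiener_index V E / real n
       \<and> (0 < \<alpha> \<and> \<alpha> < 2 * real n / (3 * real n - 2) \<longrightarrow>
            (gen_distance_energy V E vs \<alpha>
               = \<alpha> * real n + 2 * real n - 4 + sqrt k - 4 * \<alpha> * wiener_index V E / real n
             \<longleftrightarrow> is_star V E))"
proof -
  interpret enumerated_tree V E vs \<alpha>
    using assms by unfold_locales
  have bound: "\<alpha> * real n + 2 * real n - 4 + sqrt k - 4 * \<alpha> * wiener_index V E / real n
      = 2 * (star_root - mean)"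
    using assms(2,7) by (simp add: star_root_def disc_def mean_def algebra_simps)
  have star: "gen_distance_energy V E vs \<alpha> \<le> 2 * (star_root - mean)"
    if "is_star V E" "\<alpha> < 2 * real n / (3 * real n - 2)"
    using that star_energy_le assms(2) unfolding is_star_def by blast
  \<comment> \<open>For a star the lower and the upper bound meet; otherwise the strict lower bound
    excludes equality.\<close>
  show ?thesis
    unfolding bound using energy_lower_bound star by (cases "is_star V E") auto
qed

end
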